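(* Let $k$ be an algebraically closed field of characteristic $0$, let $n \ge 1$ and $d \ge 2$. Then the set of $f\in\mathrm{End}^n_d$ having a periodic critical point (a point $P\in C_f$ with $f^s(P)=P$ for some $s\ge1$) is Zariski dense in $\mathrm{End}^n_d$.
   Context: $\mathrm{End}^n_d$ is the (Zariski open) subset of the projective space of $(n+1)$-tuples $(f_0:\dots:f_n)$ of degree-$d$ homogeneous forms in $n+1$ variables over $k$ consisting of those tuples with no common nontrivial zero, i.e. defining a morphism $\mathbb{P}^n\to\mathbb{P}^n$ of degree $d$. The critical locus of $f$ is $C_f=V(J_f)$ where $J_f=\det(\partial f_i/\partial x_j)_{0\le i,j\le n}$. *)

theory Defs
  imports "HOL-Computational_Algebra.Polynomial" "Jordan_Normal_Form.Determinant"
begin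

text \<open>Exponent vectors of monomials of degree d in the n+1 variables x_0..x_n are
  lists of length n+1 summing to d.  A point of the coefficient space of
  (n+1)-tuples of degree-d forms is a function c on index pairs (i, alpha),
  i = 0..n, giving the coefficient of x^alpha in f_i; it is zero outside the
  index set.  Points of P^n are represented by vectors x :: nat => 'k
  (only coordinates 0..n matter).\<close>

definition deg_monos :: "nat \<Rightarrow> nat \<Rightarrow> nat list set" where
  "deg_monos n d = {\<alpha>. length \<alpha> = n + 1 \<and> sum_list \<alpha> = d}"

definition coeff_idx :: "nat \<Rightarrow> nat \<Rightarrow> (nat \<times> nat list) set" where
  "coeff_idx n d = {(i, \<alpha>). i \<le> n \<and> \<alpha> \<in> deg_monos n d}"

definition mono_eval :: "nat \<Rightarrow> nat list \<Rightarrow> (nat \<Rightarrow> 'k::comm_ring_1) \<Rightarrow> 'k" where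
  "mono_eval n \<alpha> x = (\<Prod>l\<le>n. x l ^ (\<alpha> ! l))"

definition form_eval :: "nat \<Rightarrow> nat \<Rightarrow> (nat \<times> nat list \<Rightarrow> 'k::comm_ring_1) \<Rightarrow> nat \<Rightarrow> (nat \<Rightarrow> 'k) \<Rightarrow> 'k" where
  "form_eval n d c i x = (\<Sum>\<alpha>\<in>deg_monos n d. c (i, \<alpha>) * mono_eval n \<alpha> x)"

definition form_deriv_eval :: "nat \<Rightarrow> nat \<Rightarrow> (nat \<times> nat list \<Rightarrow> 'k::comm_ring_1) \<Rightarrow> nat \<Rightarrow> nat \<Rightarrow> (nat \<Rightarrow> 'k) \<Rightarrow> 'k" where
  "form_deriv_eval n d c i j x =
     (\<Sum>\<alpha>\<in>deg_monos n d. c (i, \<alpha>) * of_nat (\<alpha> ! j) *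
        (\<Prod>l\<le>n. x l ^ (if l = j then \<alpha> ! l - 1 else \<alpha> ! l)))"

definition map_rep :: "nat \<Rightarrow> nat \<Rightarrow> (nat \<times> nat list \<Rightarrow> 'k::comm_ring_1) \<Rightarrow> (nat \<Rightarrow> 'k) \<Rightarrow> (nat \<Rightarrow> 'k)" where
  "map_rep n d c x = (\<lambda>i. if i \<le> n then form_eval n d c i x else 0)"

definition nontrivial :: "nat \<Rightarrow> (nat \<Rightarrow> 'k::zero) \<Rightarrow> bool" where
  "nontrivial n x \<longleftrightarrow> (\<exists>j\<le>n. x j \<noteq> 0)"

definition proj_eq :: "nat \<Rightarrow> (nat \<Rightarrow> 'k::field) \<Rightarrow> (nat \<Rightarrow> 'k) \<Rightarrow> bool" where
  "proj_eq n x y \<longleftrightarrow> (\<exists>t. t \<noteq> 0 \<and> (\<forall>j\<le>n. y j = t * x j))"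

definition End_rep :: "nat \<Rightarrow> nat \<Rightarrow> (nat \<times> nat list \<Rightarrow> 'k::field) \<Rightarrow> bool" where
  "End_rep n d c \<longleftrightarrow> (\<forall>p. p \<notin> coeff_idx n d \<longrightarrow> c p = 0) \<and>
     (\<forall>x. nontrivial n x \<longrightarrow> (\<exists>i\<le>n. form_eval n d c i x \<noteq> 0))"

definition jac_eval :: "nat \<Rightarrow> nat \<Rightarrow> (nat \<times> nat list \<Rightarrow> 'k::comm_ring_1) \<Rightarrow> (nat \<Rightarrow> 'k) \<Rightarrow> 'k" where
  "jac_eval n d c x = det (mat (n + 1) (n + 1) (\<lambda>(i, j). form_deriv_eval n d c i j x))"

definition has_periodic_crit_pt :: "nat \<Rightarrow> nat \<Rightarrow> (nat \<times> nat list \<Rightarrow> 'k::field) \<Rightarrow> bool" where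
  "has_periodic_crit_pt n d c \<longleftrightarrow>
     (\<exists>P s. nontrivial n P \<and> jac_eval n d c P = 0 \<and> s \<ge> 1 \<and>
        proj_eq n P ((map_rep n d c ^^ s) P))"

text \<open>A homogeneous polynomial G of degree e in the coordinates of the coefficient space,
  given by a finite set B of distinct exponent vectors (functions coeff_idx -> nat) with
  coefficients a; its value at the point c.\<close>
definition hpoly :: "nat \<Rightarrow> nat \<Rightarrow> nat \<Rightarrow> ((nat \<times> nat list \<Rightarrow> nat) set) \<Rightarrow> bool" where
  "hpoly n d e B \<longleftrightarrow> finite B \<and>
     (\<forall>\<beta>\<in>B. (\<forall>v. v \<notin> coeff_idx n d \<longrightarrow> \<beta> v = 0) \<and> (\<Sum>v\<in>coeff_idx n d. \<beta> v) = e)"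

definition hpoly_eval :: "nat \<Rightarrow> nat \<Rightarrow> ((nat \<times> nat list \<Rightarrow> nat) set) \<Rightarrow> ((nat \<times> nat list \<Rightarrow> nat) \<Rightarrow> 'k::comm_ring_1)
    \<Rightarrow> (nat \<times> nat list \<Rightarrow> 'k) \<Rightarrow> 'k" where
  "hpoly_eval n d B a c = (\<Sum>\<beta>\<in>B. a \<beta> * (\<Prod>v\<in>coeff_idx n d. c v ^ \<beta> v))"

text \<open>Zariski density of S in End^n_d (projective Zariski topology): every nonempty basic
  open subset D_+(G) \<inter> End^n_d of End^n_d meets S.  Basic opens form a basis, so this is
  density.\<close>
definition zariski_dense_in_End :: "nat \<Rightarrow> nat \<Rightarrow> ((nat \<times> nat list \<Rightarrow> 'k::field) \<Rightarrow> bool) \<Rightarrow> bool" where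
  "zariski_dense_in_End n d S \<longleftrightarrow>
     (\<forall>e B a. hpoly n d e B \<longrightarrow>
        (\<exists>c. End_rep n d c \<and> hpoly_eval n d B a c \<noteq> 0) \<longrightarrow>
        (\<exists>c. End_rep n d c \<and> hpoly_eval n d B a c \<noteq> 0 \<and> S c))"

end

theory Submission
  imports Defs "Jordan_Normal_Form.Char_Poly" "HOL-Computational_Algebra.Polynomial_FPS"
begin

text \<open>Let G be nonzero at c0, let P be a critical point of c0 and w a kernel vector of its derivative
  there. In linear coordinates sending P and w to coordinate vectors, let b0 be the power map, join
  b0 to c0 by the segment b0 + \<epsilon> (c0 - b0), and compose with the translations by T of the affine chart
  around P. Postcomposition does not move critical points, so P is critical throughout the family.
  At \<epsilon> = 0 the map is the product of the z^d + t_j and P is the origin. The parameters t for which 0 is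
  periodic under z^d + t are simple roots of the period polynomials (Gleason) and there are infinitely
  many of them, so the t_j can be chosen among them with the leading \<epsilon>-coefficient of G nonzero at t.
  Hensel's lemma over k[[\<epsilon>]] deforms t to a power series T for which P stays periodic, and G does not
  vanish at the resulting point. Finally a k-algebra homomorphism from a finitely generated subalgebra of
  k[[\<epsilon>]] to k specializes \<epsilon> and T so that G remains nonzero and \<epsilon> avoids the finitely many values at
  which the segment leaves End.\<close>

section \<open>Specialization of finitely generated domains\<close>

text \<open>The point P returns to itself when n affine coordinates vanish, and the translations
  supply n unknowns T_j, so isolated solutions are to be expected. At \<epsilon> = 0 the equations
  decouple: the Jacobian is diagonal, with the derivatives of the period polynomials as entries,
  which is why simple roots suffice for Hensel. The segment is there because it reaches the given
  map at \<epsilon> = 1, T = 0, so that G does not vanish identically on the family. The obstacle is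
  that T is determined by t and could run inside the zero set of G. Taking the least order m at
  which G is nonzero for some constant t settles this: at order m only T(0) = t matters, so t can be
  chosen before T exists. The T obtained is a formal series that cannot be evaluated at a number; a
  homomorphism on a subalgebra containing the finitely many series involved takes the place of
  evaluation. The translations are unipotent, so being a morphism is a condition on \<epsilon>
  alone.\<close>

definition is_subring :: "'r::comm_ring_1 set \<Rightarrow> bool" where
  "is_subring A \<longleftrightarrow> 1 \<in> A \<and> (\<forall>x\<in>A. \<forall>y\<in>A. x - y \<in> A \<and> x * y \<in> A)"

context
  fixes A :: "'r::comm_ring_1 set"
  assumes A: "is_subring A"
begin

lemma subring_one: "1 \<in> A"
  and subring_diff: "x \<in> A \<Longrightarrow> y \<in> A \<Longrightarrow> x - y \<in> A"
  and subring_mult: "x \<in> A \<Longrightarrow> y \<in> A \<Longrightarrow> x * y \<in> A"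
  using A by (auto simp: is_subring_def)

lemma subring_zero: "0 \<in> A"
  using subring_diff[OF subring_one subring_one] by simp

lemma subring_uminus: "x \<in> A \<Longrightarrow> - x \<in> A"
  using subring_diff[OF subring_zero, of x] by simp

lemma subring_add: "x \<in> A \<Longrightarrow> y \<in> A \<Longrightarrow> x + y \<in> A"
  using subring_diff[OF _ subring_uminus, of x y] by simp

lemma subring_sum: "(\<And>i. i \<in> I \<Longrightarrow> f i \<in> A) \<Longrightarrow> sum f I \<in> A"
  by (induction I rule: infinite_finite_induct) (auto intro: subring_zero subring_add)

lemma subring_prod: "(\<And>i. i \<in> I \<Longrightarrow> f i \<in> A) \<Longrightarrow> prod f I \<in> A"
  by (induction I rule: infinite_finite_induct) (auto intro: subring_one subring_mult)

lemma subring_power: "x \<in> A \<Longrightarrow> x ^ m \<in> A"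
  by (induction m) (auto intro: subring_one subring_mult)

lemmas subring_closed = subring_one subring_zero subring_diff subring_mult subring_add
  subring_uminus subring_power

end

text \<open>Nothing is required of \<phi> outside A, so a homomorphism of a subalgebra is a total
  function on the ambient ring.\<close>

definition hom_on :: "'r::comm_ring_1 set \<Rightarrow> ('r \<Rightarrow> 's::comm_ring_1) \<Rightarrow> bool" where
  "hom_on A \<phi> \<longleftrightarrow> is_subring A \<and> \<phi> 1 = 1 \<and>
     (\<forall>x\<in>A. \<forall>y\<in>A. \<phi> (x + y) = \<phi> x + \<phi> y \<and> \<phi> (x * y) = \<phi> x * \<phi> y)"

context
  fixes A :: "'r::comm_ring_1 set" and \<phi> :: "'r \<Rightarrow> 's::comm_ring_1"
  assumes hom: "hom_on A \<phi>"
begin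

lemma hom_on_subring: "is_subring A"
  and hom_on_one: "\<phi> 1 = 1"
  and hom_on_add: "x \<in> A \<Longrightarrow> y \<in> A \<Longrightarrow> \<phi> (x + y) = \<phi> x + \<phi> y"
  and hom_on_mult: "x \<in> A \<Longrightarrow> y \<in> A \<Longrightarrow> \<phi> (x * y) = \<phi> x * \<phi> y"
  using hom by (auto simp: hom_on_def)

lemma hom_on_zero: "\<phi> 0 = 0"
  using hom_on_add[of 0 0] subring_zero[OF hom_on_subring] by simp

lemma hom_on_uminus: "x \<in> A \<Longrightarrow> \<phi> (- x) = - \<phi> x"
  using hom_on_add[of x "- x"] subring_uminus[OF hom_on_subring, of x] hom_on_zero
  by (simp add: add_eq_0_iff)

lemma hom_on_diff: "x \<in> A \<Longrightarrow> y \<in> A \<Longrightarrow> \<phi> (x - y) = \<phi> x - \<phi> y"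
  using hom_on_add[of x "- y"] subring_uminus[OF hom_on_subring, of y] hom_on_uminus[of y] by simp

lemma hom_on_sum: "(\<And>i. i \<in> I \<Longrightarrow> f i \<in> A) \<Longrightarrow> \<phi> (sum f I) = (\<Sum>i\<in>I. \<phi> (f i))"
  by (induction I rule: infinite_finite_induct)
     (auto simp: hom_on_zero hom_on_add subring_sum[OF hom_on_subring])

lemma hom_on_prod: "(\<And>i. i \<in> I \<Longrightarrow> f i \<in> A) \<Longrightarrow> \<phi> (prod f I) = (\<Prod>i\<in>I. \<phi> (f i))"
  by (induction I rule: infinite_finite_induct)
     (auto simp: hom_on_one hom_on_mult subring_prod[OF hom_on_subring])

lemma hom_on_power: "x \<in> A \<Longrightarrow> \<phi> (x ^ m) = \<phi> x ^ m"
  by (induction m) (auto simp: hom_on_one hom_on_mult subring_power[OF hom_on_subring])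

lemma hom_on_mono_eval:
  assumes "\<And>l. x l \<in> A"
  shows "mono_eval n \<alpha> x \<in> A" "\<phi> (mono_eval n \<alpha> x) = mono_eval n \<alpha> (\<lambda>l. \<phi> (x l))"
  using assms unfolding mono_eval_def
  by (auto intro!: subring_prod subring_power hom_on_subring simp: hom_on_prod hom_on_power
      subring_power[OF hom_on_subring])

lemma hom_on_form_eval:
  assumes "\<And>v. c v \<in> A" "\<And>l. x l \<in> A"
  shows "form_eval n d c i x \<in> A"
    and "\<phi> (form_eval n d c i x) = form_eval n d (\<lambda>v. \<phi> (c v)) i (\<lambda>l. \<phi> (x l))"
proof -
  note S = hom_on_subring
  have *: "c (i, \<alpha>) * mono_eval n \<alpha> x \<in> A" for \<alpha>
    using assms by (intro subring_mult[OF S] hom_on_mono_eval) auto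
  show "form_eval n d c i x \<in> A"
    unfolding form_eval_def using * by (intro subring_sum[OF S])
  show "\<phi> (form_eval n d c i x) = form_eval n d (\<lambda>v. \<phi> (c v)) i (\<lambda>l. \<phi> (x l))"
    unfolding form_eval_def using * assms
    by (simp add: hom_on_sum hom_on_mult hom_on_mono_eval)
qed

lemma hom_on_map_rep_iterate:
  assumes "\<And>v. c v \<in> A" "\<And>l. x l \<in> A"
  shows "(map_rep n d c ^^ s) x l \<in> A \<and>
    \<phi> ((map_rep n d c ^^ s) x l) = (map_rep n d (\<lambda>v. \<phi> (c v)) ^^ s) (\<lambda>l. \<phi> (x l)) l"
proof (induction s arbitrary: l)
  case (Suc s)
  let ?y = "(map_rep n d c ^^ s) x"
  have y: "\<And>l. ?y l \<in> A" and e: "(\<lambda>l. \<phi> (?y l)) = (map_rep n d (\<lambda>v. \<phi> (c v)) ^^ s) (\<lambda>l. \<phi> (x l))"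
    using Suc by auto
  have "map_rep n d c ?y l \<in> A \<and> \<phi> (map_rep n d c ?y l) = map_rep n d (\<lambda>v. \<phi> (c v)) (\<lambda>l. \<phi> (?y l)) l"
    using hom_on_form_eval[of c, OF assms(1) y, where n = n and d = d]
    by (simp add: map_rep_def hom_on_zero subring_zero[OF hom_on_subring])
  then show ?case unfolding e by simp
qed (use assms in auto)

lemma hom_on_hpoly_eval:
  assumes "\<And>\<beta>. a \<beta> \<in> A" "\<And>v. c v \<in> A"
  shows "hpoly_eval n d B a c \<in> A"
    and "\<phi> (hpoly_eval n d B a c) = hpoly_eval n d B (\<lambda>\<beta>. \<phi> (a \<beta>)) (\<lambda>v. \<phi> (c v))"
proof -
  note S = hom_on_subring
  have 1: "c v ^ m \<in> A" for v m using assms by (intro subring_power[OF S])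
  have 2: "(\<Prod>v\<in>coeff_idx n d. c v ^ \<beta> v) \<in> A" for \<beta> using 1 by (intro subring_prod[OF S])
  have 3: "a \<beta> * (\<Prod>v\<in>coeff_idx n d. c v ^ \<beta> v) \<in> A" for \<beta>
    using assms 2 by (intro subring_mult[OF S])
  show "hpoly_eval n d B a c \<in> A"
    unfolding hpoly_eval_def using 3 by (intro subring_sum[OF S])
  show "\<phi> (hpoly_eval n d B a c) = hpoly_eval n d B (\<lambda>\<beta>. \<phi> (a \<beta>)) (\<lambda>v. \<phi> (c v))"
    unfolding hpoly_eval_def using 1 2 3 assms
    by (simp add: hom_on_sum hom_on_mult hom_on_prod hom_on_power)
qed

end

section \<open>Polynomials over a subring and adjunction of one element\<close>

definition polys_over :: "'r::comm_ring_1 set \<Rightarrow> 'r poly set" where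
  "polys_over A = {p. \<forall>i. coeff p i \<in> A}"

lemma polys_over_subring:
  assumes "is_subring A"
  shows "is_subring (polys_over A)"
  unfolding is_subring_def polys_over_def
  using subring_closed[OF assms]
  by (auto simp: coeff_mult intro!: subring_sum[OF assms])

lemma polys_over_const: "is_subring A \<Longrightarrow> a \<in> A \<Longrightarrow> [:a:] \<in> polys_over A"
  by (auto simp: polys_over_def coeff_pCons subring_zero split: nat.splits)

lemma polys_over_monom: "is_subring A \<Longrightarrow> a \<in> A \<Longrightarrow> monom a m \<in> polys_over A"
  by (auto simp: polys_over_def subring_zero)

lemma polys_over_smult: "is_subring A \<Longrightarrow> a \<in> A \<Longrightarrow> p \<in> polys_over A \<Longrightarrow> smult a p \<in> polys_over A"
  by (auto simp: polys_over_def subring_mult)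

lemma map_poly_const: "\<phi> 0 = 0 \<Longrightarrow> map_poly \<phi> [:e:] = [:\<phi> e:]"
  by (simp add: poly_eq_iff coeff_map_poly coeff_pCons split: nat.splits)

lemma hom_on_map_poly:
  assumes "hom_on A \<phi>"
  shows "hom_on (polys_over A) (map_poly \<phi>)"
proof -
  note S = hom_on_subring[OF assms] and Z = hom_on_zero[OF assms]
  have *: "p \<in> polys_over A \<Longrightarrow> coeff p i \<in> A" for p i by (auto simp: polys_over_def)
  show ?thesis
    unfolding hom_on_def
  proof (intro conjI ballI)
    show "is_subring (polys_over A)" using S by (rule polys_over_subring)
    show "map_poly \<phi> 1 = 1" by (simp add: hom_on_one[OF assms])
    fix p q assume pq: "p \<in> polys_over A" "q \<in> polys_over A"
    show "map_poly \<phi> (p + q) = map_poly \<phi> p + map_poly \<phi> q"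
      using pq by (auto simp: poly_eq_iff coeff_map_poly Z * hom_on_add[OF assms])
    show "map_poly \<phi> (p * q) = map_poly \<phi> p * map_poly \<phi> q"
      using pq
      by (auto simp: poly_eq_iff coeff_map_poly Z coeff_mult * hom_on_sum[OF assms]
          hom_on_mult[OF assms] subring_mult[OF S])
  qed
qed

definition adjoin :: "'r::comm_ring_1 set \<Rightarrow> 'r \<Rightarrow> 'r set" where
  "adjoin A x = (\<lambda>p. poly p x) ` polys_over A"

lemma adjoin_subring:
  assumes "is_subring A"
  shows "is_subring (adjoin A x)"
  unfolding is_subring_def
proof (intro conjI ballI)
  note P = polys_over_subring[OF assms]
  show "1 \<in> adjoin A x"
    unfolding adjoin_def using subring_one[OF P] by (auto intro!: image_eqI[of _ _ 1])
  fix y z assume "y \<in> adjoin A x" "z \<in> adjoin A x"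
  then obtain p q where pq: "p \<in> polys_over A" "q \<in> polys_over A" "y = poly p x" "z = poly q x"
    by (auto simp: adjoin_def)
  show "y - z \<in> adjoin A x"
    unfolding adjoin_def using subring_diff[OF P pq(1,2)] pq by (auto intro!: image_eqI[of _ _ "p - q"])
  show "y * z \<in> adjoin A x"
    unfolding adjoin_def using subring_mult[OF P pq(1,2)] pq by (auto intro!: image_eqI[of _ _ "p * q"])
qed

lemma adjoin_supset: "is_subring A \<Longrightarrow> A \<subseteq> adjoin A x"
  unfolding adjoin_def by (auto intro!: image_eqI[of _ _ "[:_:]"] polys_over_const)

lemma adjoin_self: "is_subring A \<Longrightarrow> x \<in> adjoin A x"
  unfolding adjoin_def
  by (auto intro!: image_eqI[of _ _ "monom 1 1"] polys_over_monom subring_one simp: poly_monom)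

text \<open>By \<open>rel\<close> every relation of x over A also holds for y, so the value does not
  depend on the polynomial chosen to represent an element of A[x].\<close>

lemma extend_hom:
  assumes hom: "hom_on A \<phi>"
    and rel: "\<And>q. q \<in> polys_over A \<Longrightarrow> poly q x = 0 \<Longrightarrow> poly (map_poly \<phi> q) y = 0"
  obtains \<phi>' where "hom_on (adjoin A x) \<phi>'"
    "\<And>q. q \<in> polys_over A \<Longrightarrow> \<phi>' (poly q x) = poly (map_poly \<phi> q) y"
proof -
  note S = hom_on_subring[OF hom]
  note P = polys_over_subring[OF S] and M = hom_on_map_poly[OF hom]
  define \<phi>' where "\<phi>' z = poly (map_poly \<phi> (SOME q. q \<in> polys_over A \<and> poly q x = z)) y" for z
  have ev: "\<phi>' (poly q x) = poly (map_poly \<phi> q) y" if q: "q \<in> polys_over A" for q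
  proof -
    define r where "r = (SOME r. r \<in> polys_over A \<and> poly r x = poly q x)"
    have r: "r \<in> polys_over A \<and> poly r x = poly q x"
      unfolding r_def by (rule someI[of _ q]) (use q in auto)
    have "poly (map_poly \<phi> (r - q)) y = 0"
      using r q subring_diff[OF P] by (intro rel) auto
    then have "poly (map_poly \<phi> r) y = poly (map_poly \<phi> q) y"
      using r q by (simp add: hom_on_diff[OF M])
    then show ?thesis by (simp add: \<phi>'_def r_def)
  qed
  have "hom_on (adjoin A x) \<phi>'"
    unfolding hom_on_def
  proof (intro conjI ballI)
    show "is_subring (adjoin A x)" using S by (rule adjoin_subring)
    show "\<phi>' 1 = 1" using ev[of 1] subring_one[OF P] hom_on_one[OF M] by simp
    fix z w assume "z \<in> adjoin A x" "w \<in> adjoin A x"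
    then obtain p q where pq: "p \<in> polys_over A" "q \<in> polys_over A" "z = poly p x" "w = poly q x"
      by (auto simp: adjoin_def)
    show "\<phi>' (z + w) = \<phi>' z + \<phi>' w"
      using ev[OF subring_add[OF P pq(1,2)]] ev[OF pq(1)] ev[OF pq(2)] pq hom_on_add[OF M pq(1,2)]
      by simp
    show "\<phi>' (z * w) = \<phi>' z * \<phi>' w"
      using ev[OF subring_mult[OF P pq(1,2)]] ev[OF pq(1)] ev[OF pq(2)] pq hom_on_mult[OF M pq(1,2)]
      by simp
  qed
  then show thesis using ev by (rule that)
qed

text \<open>The leading coefficient of q need not be invertible in A; a power of it clears
  denominators and keeps quotient and remainder over A.\<close>

lemma pseudo_division_over:
  fixes p q :: "'r::idom poly"
  assumes S: "is_subring A" and p: "p \<in> polys_over A" and q: "q \<in> polys_over A" "q \<noteq> 0"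
  shows "\<exists>k w r. w \<in> polys_over A \<and> r \<in> polys_over A \<and> (r = 0 \<or> degree r < degree q) \<and>
    smult (lead_coeff q ^ k) p = q * w + r"
  using p
proof (induction "degree p" arbitrary: p rule: less_induct)
  case less
  note P = polys_over_subring[OF S]
  have cA: "f \<in> polys_over A \<Longrightarrow> coeff f i \<in> A" for f i by (auto simp: polys_over_def)
  show ?case
  proof (cases "p = 0 \<or> degree p < degree q")
    case True
    then show ?thesis
      using less.prems subring_zero[OF P]
      by (intro exI[of _ 0] exI[of _ p]) auto
  next
    case False
    then have pq: "p \<noteq> 0" "degree q \<le> degree p" by auto
    define u where "u = monom (lead_coeff p) (degree p - degree q)"
    define p' where "p' = smult (lead_coeff q) p - q * u"
    have u: "u \<in> polys_over A" unfolding u_def using cA less.prems by (intro polys_over_monom S)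
    have p'A: "p' \<in> polys_over A" unfolding p'_def
      using u q cA less.prems by (intro subring_diff[OF P] subring_mult[OF P] polys_over_smult[OF S]) auto
    have small: "p' = 0 \<or> degree p' < degree p"
    proof (cases "p' = 0")
      case False
      have "degree p' \<le> degree p"
        unfolding p'_def u_def using pq
        by (intro degree_diff_le) (auto intro!: order.trans[OF degree_mult_le] simp: degree_monom_eq)
      moreover have "coeff p' (degree p) = 0"
      proof -
        have "coeff (q * u) (degree p) = coeff (q * u) (degree q + degree u)"
          using pq by (simp add: u_def degree_monom_eq)
        also have "\<dots> = lead_coeff q * lead_coeff u" by (rule coeff_mult_degree_sum)
        finally show ?thesis using pq by (simp add: p'_def u_def degree_monom_eq)
      qed
      ultimately show ?thesis
        using False by (metis le_neq_implies_less leading_coeff_0_iff)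
    qed auto
    have "\<exists>k w r. w \<in> polys_over A \<and> r \<in> polys_over A \<and> (r = 0 \<or> degree r < degree q) \<and>
      smult (lead_coeff q ^ k) p' = q * w + r"
    proof (cases "p' = 0")
      case True
      then show ?thesis using subring_zero[OF P] by (intro exI[of _ 0]) auto
    next
      case False
      then show ?thesis using small less.hyps[OF _ p'A] by auto
    qed
    then obtain k w r where kwr: "w \<in> polys_over A" "r \<in> polys_over A" "r = 0 \<or> degree r < degree q"
      "smult (lead_coeff q ^ k) p' = q * w + r" by blast
    have "smult (lead_coeff q ^ k) (smult (lead_coeff q) p) = smult (lead_coeff q ^ k) (p' + q * u)"
      by (simp add: p'_def)
    also have "\<dots> = q * (w + smult (lead_coeff q ^ k) u) + r"
      using kwr(4) by (simp add: smult_add_right distrib_left)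
    finally have "smult (lead_coeff q ^ Suc k) p = q * (w + smult (lead_coeff q ^ k) u) + r"
      by (simp add: mult.commute)
    moreover have "w + smult (lead_coeff q ^ k) u \<in> polys_over A"
      using kwr u q cA by (intro subring_add[OF P] polys_over_smult[OF S] subring_power[OF S]) auto
    ultimately show ?thesis using kwr by blast
  qed
qed

text \<open>A strong form of the Nullstellensatz: k-algebra homomorphisms to k detect every nonzero
  h. Quantifying over all h lets the property pass through one adjunction at a time.\<close>

definition specializable :: "('k::field \<Rightarrow> 'r::idom) \<Rightarrow> 'r set \<Rightarrow> bool" where
  "specializable \<kappa> A \<longleftrightarrow> is_subring A \<and> range \<kappa> \<subseteq> A \<and>
     (\<forall>h\<in>A. h \<noteq> 0 \<longrightarrow> (\<exists>\<phi>. hom_on A \<phi> \<and> (\<forall>a. \<phi> (\<kappa> a) = a) \<and> \<phi> h \<noteq> (0::'k)))"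

text \<open>A[x] is a polynomial ring here. A homomorphism that keeps the leading coefficient of h
  keeps a nonzero polynomial over the infinite field k, and x goes to a nonroot of it.\<close>

lemma specializable_adjoin_transcendental:
  fixes \<kappa> :: "'k::{field, ring_char_0} \<Rightarrow> 'r::idom"
  assumes A: "specializable \<kappa> A"
    and tr: "\<And>q. q \<in> polys_over A \<Longrightarrow> poly q x = 0 \<Longrightarrow> q = 0"
  shows "specializable \<kappa> (adjoin A x)"
  unfolding specializable_def
proof (intro conjI ballI impI)
  have S: "is_subring A" and \<kappa>: "range \<kappa> \<subseteq> A" using A by (auto simp: specializable_def)
  show "is_subring (adjoin A x)" using S by (rule adjoin_subring)
  show "range \<kappa> \<subseteq> adjoin A x" using \<kappa> adjoin_supset[OF S] by blast
  fix h assume "h \<in> adjoin A x" "h \<noteq> 0"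
  then obtain q where q: "q \<in> polys_over A" "h = poly q x" by (auto simp: adjoin_def)
  with \<open>h \<noteq> 0\<close> have q0: "q \<noteq> 0" by auto
  then have "lead_coeff q \<in> A" "lead_coeff q \<noteq> 0" using q q0 by (auto simp: polys_over_def)
  then obtain \<phi> where \<phi>: "hom_on A \<phi>" "\<And>a. \<phi> (\<kappa> a) = a" "\<phi> (lead_coeff q) \<noteq> 0"
    using A unfolding specializable_def by blast
  have "coeff (map_poly \<phi> q) (degree q) \<noteq> 0"
    using \<phi> by (simp add: coeff_map_poly hom_on_zero)
  then have "map_poly \<phi> q \<noteq> 0" by auto
  then obtain y where y: "poly (map_poly \<phi> q) y \<noteq> 0" using poly_all_0_iff_0 by blast
  obtain \<phi>' where \<phi>': "hom_on (adjoin A x) \<phi>'"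
    "\<And>q. q \<in> polys_over A \<Longrightarrow> \<phi>' (poly q x) = poly (map_poly \<phi> q) y"
    by (rule extend_hom[OF \<phi>(1), of x y]) (auto dest: tr)
  have "\<phi>' (\<kappa> a) = a" for a
    using \<phi>'(2)[OF polys_over_const[OF S, of "\<kappa> a"]] \<kappa> \<phi>(2) hom_on_zero[OF \<phi>(1)]
    by (auto simp: map_poly_const)
  then show "\<exists>\<phi>. hom_on (adjoin A x) \<phi> \<and> (\<forall>a. \<phi> (\<kappa> a) = a) \<and> \<phi> h \<noteq> 0"
    using \<phi>' q y by auto
qed

text \<open>The element x goes to a root of the image of an annihilating polynomial p of least
  degree, with leading coefficient a. To keep h from dying, a nonzero element b = v(x) a^k h of A is
  produced, and the homomorphism on A is chosen to kill neither a nor b.\<close>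

lemma specializable_adjoin_algebraic:
  fixes \<kappa> :: "'k::alg_closed_field \<Rightarrow> 'r::idom"
  assumes A: "specializable \<kappa> A"
    and alg: "q0 \<in> polys_over A" "poly q0 x = 0" "q0 \<noteq> 0"
  shows "specializable \<kappa> (adjoin A x)"
  unfolding specializable_def
proof (intro conjI ballI impI)
  have S: "is_subring A" and \<kappa>: "range \<kappa> \<subseteq> A" using A by (auto simp: specializable_def)
  note P = polys_over_subring[OF S]
  have cA: "f \<in> polys_over A \<Longrightarrow> coeff f i \<in> A" for f i by (auto simp: polys_over_def)
  show "is_subring (adjoin A x)" using S by (rule adjoin_subring)
  show "range \<kappa> \<subseteq> adjoin A x" using \<kappa> adjoin_supset[OF S] by blast
  obtain p where p: "p \<in> polys_over A" "poly p x = 0" "p \<noteq> 0"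
    and pmin: "\<And>q. q \<in> polys_over A \<Longrightarrow> poly q x = 0 \<Longrightarrow> degree q < degree p \<Longrightarrow> q = 0"
    using ex_has_least_nat[of "\<lambda>q. q \<in> polys_over A \<and> poly q x = 0 \<and> q \<noteq> 0" q0 degree] alg
    by (metis linorder_not_less)
  have degp: "degree p > 0"
  proof (rule ccontr)
    assume "\<not> 0 < degree p"
    then obtain a where "p = [:a:]" using degree_eq_zeroE by blast
    with p show False by auto
  qed
  \<comment> \<open>Euclid's algorithm against p: dividing p by q replaces q by a remainder of
    smaller degree until a nonzero constant of A is reached.\<close>
  have ann: "\<exists>v\<in>polys_over A. \<exists>b\<in>A. b \<noteq> 0 \<and> poly (v * q) x = b"
    if "q \<in> polys_over A" "poly q x \<noteq> 0" "degree q < degree p" for q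
    using that
  proof (induction "degree q" arbitrary: q rule: less_induct)
    case less
    show ?case
    proof (cases "degree q = 0")
      case True
      then obtain a where "q = [:a:]" using degree_eq_zeroE by blast
      then show ?thesis using less.prems cA[of q 0] subring_one[OF P] by (intro bexI[of _ 1] bexI[of _ a]) auto
    next
      case False
      have q0: "q \<noteq> 0" using less.prems by auto
      obtain k w r where kwr: "w \<in> polys_over A" "r \<in> polys_over A" "r = 0 \<or> degree r < degree q"
        "smult (lead_coeff q ^ k) p = q * w + r"
        using pseudo_division_over[OF S p(1) less.prems(1) q0] by blast
      have ev: "poly q x * poly w x + poly r x = 0"
        using arg_cong[OF kwr(4), of "\<lambda>f. poly f x"] p(2) by simp
      \<comment> \<open>A vanishing value forces r = 0 by minimality; then q w is a constant
        multiple of p with q(x) nonzero, so w annihilates x in degree below that of p.\<close>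
      have "poly r x \<noteq> 0"
      proof
        assume r0: "poly r x = 0"
        have "r = 0"
          using kwr r0 less.prems(3) by (cases "r = 0") (auto intro!: pmin)
        have "poly w x = 0" using ev r0 less.prems by auto
        have nz: "smult (lead_coeff q ^ k) p \<noteq> 0" using p q0 by auto
        then have w0: "w \<noteq> 0" using kwr(4) \<open>r = 0\<close> by auto
        have "degree p = degree (q * w)"
          using kwr(4) \<open>r = 0\<close> q0 by (metis add.right_neutral degree_smult_eq leading_coeff_0_iff power_eq_0_iff)
        also have "\<dots> = degree q + degree w" using q0 w0 by (rule degree_mult_eq)
        finally have "degree w < degree p" using False by simp
        with pmin[OF kwr(1) \<open>poly w x = 0\<close>] w0 show False by simp
      qed
      moreover have "degree r < degree q" using kwr(3) calculation by auto
      ultimately obtain v b where vb: "v \<in> polys_over A" "b \<in> A" "b \<noteq> 0" "poly (v * r) x = b"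
        using less.hyps[of r] kwr(2) less.prems(3) by auto
      have "poly r x = - (poly q x * poly w x)" using ev by (simp add: eq_neg_iff_add_eq_0 add.commute)
      then have "poly (- v * w * q) x = b"
        using vb(4) by (simp add: mult_ac)
      moreover have "- v * w \<in> polys_over A"
        using vb kwr by (intro subring_mult[OF P] subring_uminus[OF P])
      ultimately show ?thesis using vb by blast
    qed
  qed
  fix h assume "h \<in> adjoin A x" "h \<noteq> 0"
  then obtain q where q: "q \<in> polys_over A" "h = poly q x" "poly q x \<noteq> 0" by (auto simp: adjoin_def)
  define a where "a = lead_coeff p"
  have a: "a \<in> A" "a \<noteq> 0" using p cA by (auto simp: a_def)
  obtain k w r where kwr: "w \<in> polys_over A" "r \<in> polys_over A" "r = 0 \<or> degree r < degree p"
    "smult (a ^ k) q = p * w + r"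
    using pseudo_division_over[OF S q(1) p(1,3)] unfolding a_def by blast
  have rx: "poly r x = a ^ k * h" using arg_cong[OF kwr(4), of "\<lambda>f. poly f x"] p(2) q(2) by simp
  then have "poly r x \<noteq> 0" using a \<open>h \<noteq> 0\<close> by simp
  then obtain v b where vb: "v \<in> polys_over A" "b \<in> A" "b \<noteq> 0" "poly (v * r) x = b"
    using ann[OF kwr(2)] kwr(3) by auto
  \<comment> \<open>Keeping a nonzero preserves the degree of p, hence gives a root y, and permits
    cancelling powers of a in \<open>rel\<close>; keeping b nonzero protects h.\<close>
  have "a * b \<in> A" "a * b \<noteq> 0" using a vb subring_mult[OF S] by auto
  then obtain \<phi> where \<phi>: "hom_on A \<phi>" "\<And>a. \<phi> (\<kappa> a) = a" "\<phi> (a * b) \<noteq> 0"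
    using A unfolding specializable_def by blast
  note M = hom_on_map_poly[OF \<phi>(1)] and Z = hom_on_zero[OF \<phi>(1)]
  have \<phi>ab: "\<phi> a \<noteq> 0" "\<phi> b \<noteq> 0" using \<phi>(3) a vb by (auto simp: hom_on_mult[OF \<phi>(1)])
  have "coeff (map_poly \<phi> p) (degree p) \<noteq> 0"
    using \<phi>ab(1) unfolding a_def by (simp add: coeff_map_poly Z)
  from le_degree[OF this] obtain y where y: "poly (map_poly \<phi> p) y = 0"
    using alg_closed_imp_poly_has_root[of "map_poly \<phi> p"] degp by auto
  have smult_hom: "map_poly \<phi> (smult e f) = smult (\<phi> e) (map_poly \<phi> f)"
    if "e \<in> A" "f \<in> polys_over A" for e f
    using that cA by (auto simp: poly_eq_iff coeff_map_poly Z hom_on_mult[OF \<phi>(1)])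
  \<comment> \<open>By minimality of p, a power of a times f is a multiple of p, so the image of f
    inherits the root y.\<close>
  have rel: "poly (map_poly \<phi> f) y = 0" if f: "f \<in> polys_over A" "poly f x = 0" for f
  proof -
    obtain k w r where kwr: "w \<in> polys_over A" "r \<in> polys_over A" "r = 0 \<or> degree r < degree p"
      "smult (a ^ k) f = p * w + r"
      using pseudo_division_over[OF S f(1) p(1,3)] unfolding a_def by blast
    have "poly r x = 0" using arg_cong[OF kwr(4), of "\<lambda>f. poly f x"] p(2) f(2) by simp
    then have "r = 0" using kwr(2,3) pmin by auto
    then have "map_poly \<phi> (smult (a ^ k) f) = map_poly \<phi> (p * w)" using kwr(4) by simp
    then have "smult (\<phi> a ^ k) (map_poly \<phi> f) = map_poly \<phi> p * map_poly \<phi> w"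
      using smult_hom[of "a ^ k" f] a f subring_power[OF S] hom_on_mult[OF M p(1) kwr(1)]
      by (simp add: hom_on_power[OF \<phi>(1)])
    from arg_cong[OF this, of "\<lambda>f. poly f y"] show ?thesis using y \<phi>ab by simp
  qed
  obtain \<phi>' where \<phi>': "hom_on (adjoin A x) \<phi>'"
    "\<And>q. q \<in> polys_over A \<Longrightarrow> \<phi>' (poly q x) = poly (map_poly \<phi> q) y"
    by (rule extend_hom[OF \<phi>(1), of x y]) (auto dest: rel)
  have const: "\<phi>' e = \<phi> e" if "e \<in> A" for e
    using \<phi>'(2)[OF polys_over_const[OF S that]] Z by (auto simp: map_poly_const)
  have "\<phi>' (poly v x * (a ^ k * h)) \<noteq> 0"
    using vb(4) const[OF vb(2)] \<phi>ab rx by simp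
  moreover have "poly v x \<in> adjoin A x" "a ^ k \<in> adjoin A x" "h \<in> adjoin A x"
    using vb q subsetD[OF adjoin_supset[OF S] subring_power[OF S a(1)]] by (auto simp: adjoin_def)
  ultimately have "\<phi>' h \<noteq> 0"
    using hom_on_mult[OF \<phi>'(1)] subring_mult[OF adjoin_subring[OF S]] by auto
  then show "\<exists>\<phi>. hom_on (adjoin A x) \<phi> \<and> (\<forall>a. \<phi> (\<kappa> a) = a) \<and> \<phi> h \<noteq> 0"
    using \<phi>'(1) const[OF subsetD[OF \<kappa>]] \<phi>(2) by (auto intro!: exI[of _ \<phi>'])
qed

lemma specializable_range:
  fixes \<kappa> :: "'k::field \<Rightarrow> 'r::idom"
  assumes "hom_on UNIV \<kappa>" "inj \<kappa>"
  shows "specializable \<kappa> (range \<kappa>)"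
proof -
  have "is_subring (range \<kappa>)"
    unfolding is_subring_def
  proof (intro conjI ballI)
    show "1 \<in> range \<kappa>" using hom_on_one[OF assms(1)] by (metis rangeI)
    fix x y assume "x \<in> range \<kappa>" "y \<in> range \<kappa>"
    then show "x - y \<in> range \<kappa>" "x * y \<in> range \<kappa>"
      using hom_on_diff[OF assms(1)] hom_on_mult[OF assms(1)] by (auto simp: image_iff) metis+
  qed
  moreover have "hom_on (range \<kappa>) (the_inv \<kappa>)"
    unfolding hom_on_def
  proof (intro conjI ballI)
    show "the_inv \<kappa> 1 = 1" using hom_on_one[OF assms(1)] by (metis assms(2) the_inv_f_f)
    fix x y assume "x \<in> range \<kappa>" "y \<in> range \<kappa>"
    then obtain u v where uv: "x = \<kappa> u" "y = \<kappa> v" by auto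
    show "the_inv \<kappa> (x + y) = the_inv \<kappa> x + the_inv \<kappa> y" "the_inv \<kappa> (x * y) = the_inv \<kappa> x * the_inv \<kappa> y"
      using hom_on_add[OF assms(1), of u v] hom_on_mult[OF assms(1), of u v] uv assms(2)
      by (metis UNIV_I the_inv_f_f)+
  qed fact
  moreover have "the_inv \<kappa> h \<noteq> 0" if "h \<in> range \<kappa>" "h \<noteq> 0" for h
    using that hom_on_zero[OF assms(1)] by (auto simp: the_inv_f_f[OF assms(2)])
  ultimately show ?thesis
    unfolding specializable_def by (auto intro!: exI[of _ "the_inv \<kappa>"] simp: the_inv_f_f[OF assms(2)])
qed

theorem specializable_extension:
  fixes \<kappa> :: "'k::{alg_closed_field, field_char_0} \<Rightarrow> 'r::idom"
  assumes "hom_on UNIV \<kappa>" "inj \<kappa>" "finite X"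
  obtains A where "specializable \<kappa> A" "X \<subseteq> A"
proof -
  have "\<exists>A. specializable \<kappa> A \<and> X \<subseteq> A"
    using assms(3)
  proof (induction X)
    case empty
    then show ?case using specializable_range[OF assms(1,2)] by auto
  next
    case (insert x X)
    then obtain A where A: "specializable \<kappa> A" "X \<subseteq> A" by auto
    then have S: "is_subring A" by (simp add: specializable_def)
    have "specializable \<kappa> (adjoin A x)"
    proof (cases "\<exists>q\<in>polys_over A. poly q x = 0 \<and> q \<noteq> 0")
      case True
      then show ?thesis using specializable_adjoin_algebraic[OF A(1)] by blast
    next
      case False
      then show ?thesis using specializable_adjoin_transcendental[OF A(1)] by blast
    qed
    then show ?case using A adjoin_supset[OF S, of x] adjoin_self[OF S, of x] by blast
  qed
  then show thesis using that by blast
qed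

section \<open>Parameters with a periodic critical point in the unicritical family\<close>

text \<open>The critical orbit 0, t, t^d + t, ... of z^d + t, as polynomials in t. For s \<ge> 1 the
  roots are the parameters for which 0 has period dividing s.\<close>

definition center_poly :: "nat \<Rightarrow> nat \<Rightarrow> 'r::comm_ring_1 poly" where
  "center_poly d s = ((\<lambda>q. q ^ d + [:0, 1:]) ^^ s) 0"

lemma center_poly_0: "center_poly d 0 = 0" and center_poly_Suc: "center_poly d (Suc s) = center_poly d s ^ d + [:0, 1:]"
  by (simp_all add: center_poly_def)

text \<open>Being monic makes the roots integral over the integers; the growing degree yields
  unboundedly many of them.\<close>

lemma center_poly_degree_monic:
  assumes "d \<ge> 2"
  shows "degree (center_poly d (Suc s) :: 'r::idom poly) = d ^ s \<and> lead_coeff (center_poly d (Suc s) :: 'r poly) = 1"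
proof (induction s)
  case 0
  have "(0 :: 'r poly) ^ d = 0" using assms by simp
  then show ?case by (simp add: center_poly_0 center_poly_Suc del: power_eq_0_iff)
next
  case (Suc s)
  let ?g = "center_poly d (Suc s) :: 'r poly"
  have "?g \<noteq> 0" using Suc by auto
  from degree_power_eq[OF this, of d] have pow: "degree (?g ^ d) = d ^ Suc s" "lead_coeff (?g ^ d) = 1"
    using Suc unfolding lead_coeff_power by auto
  have "d ^ Suc s \<ge> d ^ 1" using assms by (intro power_increasing) auto
  then have "d ^ Suc s > 1" using assms unfolding power_one_right by linarith
  then have "degree [:0, 1 :: 'r:] < degree (?g ^ d)" unfolding pow(1) by simp
  from degree_add_eq_left[OF this] lead_coeff_add_le[OF this] show ?case
    unfolding center_poly_Suc[of d "Suc s"] using pow by (simp add: add.commute)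
qed

text \<open>Different coordinates receive parameters with different periods; multiples provide a
  common one.\<close>

lemma center_poly_cycle:
  fixes t :: "'r::comm_ring_1"
  assumes "poly (center_poly d s) t = 0"
  shows "poly (center_poly d (s * m)) t = 0"
proof -
  have shift: "poly (center_poly d (s + k)) t = poly (center_poly d k) t" for k
  proof (induction k)
    case 0
    then show ?case using assms by (simp add: center_poly_0)
  qed (simp add: center_poly_Suc)
  show ?thesis by (induction m) (simp_all add: center_poly_0 shift)
qed

text \<open>The derivative is 1 modulo d, which is the source of the simplicity of the roots. The
  same recursion reappears in the Jacobian of the orbit equations.\<close>

lemma pderiv_center_poly:
  assumes "d \<ge> 1"
  shows "poly (pderiv (center_poly d (Suc s))) (t::'r::idom) =
     of_nat d * poly (center_poly d s) t ^ (d - 1) * poly (pderiv (center_poly d s)) t + 1"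
proof -
  obtain e where e: "d = Suc e" using assms by (cases d) auto
  show ?thesis
    unfolding center_poly_Suc pderiv_add e pderiv_power_Suc by (simp add: pderiv_pCons)
qed

section \<open>Determinants of matrices 1 + e Q\<close>

definition one_add_mat :: "nat \<Rightarrow> 'r::comm_ring_1 \<Rightarrow> (nat \<Rightarrow> nat \<Rightarrow> 'r) \<Rightarrow> 'r mat" where
  "one_add_mat D e Q = mat D D (\<lambda>(i, j). (if i = j then 1 else 0) + e * Q i j)"

text \<open>Serves two purposes: over the integers the constant term 1 is read modulo e, and over k
  it leaves only finitely many e with 1 + e Q singular.\<close>

lemma det_one_add_poly:
  "\<exists>P. poly P 0 = 1 \<and> (\<forall>e. poly P e = det (one_add_mat D e Q))"
proof -
  define M where "M = mat D D (\<lambda>(i, j). [:if i = j then 1 else 0, Q i j:])"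
  have "poly (det M) e = det (one_add_mat D e Q)" for e
  proof -
    have hom: "comm_ring_hom (\<lambda>p. poly p e)" by unfold_locales auto
    show ?thesis
      unfolding comm_ring_hom.hom_det[OF hom, symmetric]
      by (intro arg_cong[of _ _ det] eq_matI) (auto simp: M_def one_add_mat_def)
  qed
  moreover have "one_add_mat D 0 Q = 1\<^sub>m D"
    by (rule eq_matI) (auto simp: one_add_mat_def)
  ultimately show ?thesis by (intro exI[of _ "det M"]) simp
qed

lemma det_one_add_eq_0:
  fixes v :: "nat \<Rightarrow> 'r::idom"
  assumes "i0 < D" "v i0 \<noteq> 0" "\<And>i. i < D \<Longrightarrow> v i + e * (\<Sum>j<D. Q i j * v j) = 0"
  shows "det (one_add_mat D e Q) = 0"
proof -
  have "one_add_mat D e Q *\<^sub>v vec D v = 0\<^sub>v D"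
  proof (rule eq_vecI)
    fix i assume i: "i < dim_vec (0\<^sub>v D :: 'r vec)"
    have "(one_add_mat D e Q *\<^sub>v vec D v) $ i = (\<Sum>j<D. ((if i = j then 1 else 0) + e * Q i j) * v j)"
      using i by (auto simp: one_add_mat_def scalar_prod_def lessThan_atLeast0 intro!: sum.cong)
    also have "\<dots> = (\<Sum>j<D. (if i = j then v j else 0)) + e * (\<Sum>j<D. Q i j * v j)"
      unfolding sum_distrib_left sum.distrib[symmetric] by (rule sum.cong) (simp_all add: algebra_simps)
    finally show "(one_add_mat D e Q *\<^sub>v vec D v) $ i = 0\<^sub>v D $ i" using i assms(3) by simp
  qed (simp add: one_add_mat_def)
  moreover have "vec D v \<noteq> 0\<^sub>v D" using assms(1,2) by (auto simp: vec_eq_iff)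
  ultimately show ?thesis
    by (subst det_0_iff_vec_prod_zero[of _ D])
       (auto simp: one_add_mat_def intro!: exI[of _ "vec D v"])
qed

text \<open>The index set stays abstract because the application indexes rows and columns by
  monomials.\<close>

lemma finite_inverse_eigenvalues:
  fixes N :: "'a \<Rightarrow> 'a \<Rightarrow> 'k::field"
  assumes I: "finite I"
  shows "finite {e. \<exists>v. (\<exists>i\<in>I. v i \<noteq> 0) \<and> (\<forall>i\<in>I. v i + e * (\<Sum>j\<in>I. N i j * v j) = 0)}"
proof -
  obtain h where h: "bij_betw h {..<card I} I"
    using ex_bij_betw_nat_finite[OF I] by (auto simp: lessThan_atLeast0)
  define D where "D = card I"
  obtain P where P: "poly P 0 = 1" "\<And>e. poly P e = det (one_add_mat D e (\<lambda>i j. N (h i) (h j)))"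
    using det_one_add_poly[of D "\<lambda>i j. N (h i) (h j)"] by blast
  have "poly P e = 0"
    if v: "i0 \<in> I" "v i0 \<noteq> 0" "\<forall>i\<in>I. v i + e * (\<Sum>j\<in>I. N i j * v j) = 0" for e v i0
  proof -
    have "i0 \<in> h ` {..<D}" using h v(1) by (simp add: bij_betw_def D_def)
    then obtain k where k: "k < D" "h k = i0" by auto
    have "v (h i) + e * (\<Sum>j<D. N (h i) (h j) * v (h j)) = 0" if "i < D" for i
    proof -
      have "h i \<in> I" using h that by (auto simp: bij_betw_def D_def)
      moreover have "(\<Sum>j<D. N (h i) (h j) * v (h j)) = (\<Sum>j\<in>I. N (h i) j * v j)"
        unfolding D_def by (rule sum.reindex_bij_betw[OF h])
      ultimately show ?thesis using v(3) by simp
    qed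
    then show ?thesis unfolding P using k v by (intro det_one_add_eq_0[of k _ "\<lambda>i. v (h i)"]) auto
  qed
  then have "{e. \<exists>v. (\<exists>i\<in>I. v i \<noteq> 0) \<and> (\<forall>i\<in>I. v i + e * (\<Sum>j\<in>I. N i j * v j) = 0)} \<subseteq> {e. poly P e = 0}"
    by blast
  moreover have "P \<noteq> 0" using P(1) by auto
  ultimately show ?thesis by (rule finite_subset[OF _ poly_roots_finite])
qed

text \<open>If t is a root of the monic integer polynomial p, multiplication by q(t) on 1, t, t^2, ...
  is an integer matrix Q, so 1 + m q(t) = 0 would force det (1 + m Q) = 0, which is 1 modulo m.\<close>

lemma integral_not_inverse:
  fixes t :: "'k::field_char_0" and p q :: "int poly"
  assumes p: "lead_coeff p = 1" "poly (of_int_poly p) t = 0" and m: "m \<ge> (2::int)"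
  shows "1 + of_int m * poly (of_int_poly q) t \<noteq> 0"
proof
  assume z: "1 + of_int m * poly (of_int_poly q) t = 0"
  define D where "D = degree p"
  have p0: "p \<noteq> 0" using p by auto
  have D0: "D > 0"
  proof (rule ccontr)
    assume "\<not> D > 0"
    then obtain a where "p = [:a:]" using degree_eq_zeroE unfolding D_def by blast
    with p show False by auto
  qed
  \<comment> \<open>Division by the monic p has an integer remainder, so every integer polynomial in
    t is an integer combination of 1, t, ..., t^(D-1).\<close>
  have red: "\<exists>r. poly (of_int_poly f) t = (\<Sum>j<D. of_int (r j) * t ^ j)" for f :: "int poly"
  proof -
    obtain g h where gh: "pseudo_divmod f p = (g, h)" by (cases "pseudo_divmod f p") auto
    note d = pseudo_divmod[OF p0 gh]
    have "f = p * g + h" using d(1) p by simp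
    then have "of_int_poly f = (of_int_poly p * of_int_poly g + of_int_poly h :: 'k poly)"
      by (simp add: hom_distribs)
    then have "poly (of_int_poly f) t = poly (of_int_poly h) t" using p by simp
    also have "\<dots> = (\<Sum>j<D. of_int (coeff h j) * t ^ j)"
    proof -
      have "degree (of_int_poly h :: 'k poly) < D" using d(2) D0 by (auto simp: D_def)
      then have "poly (of_int_poly h) t = (\<Sum>j<D. coeff (of_int_poly h) j * t ^ j)"
        unfolding poly_altdef by (intro sum.mono_neutral_left) (auto simp: coeff_eq_0 simp del: of_int_hom.coeff_map_poly_hom)
      then show ?thesis by simp
    qed
    finally show ?thesis by auto
  qed
  have "\<forall>i. \<exists>r. poly (of_int_poly q) t * t ^ i = (\<Sum>j<D. of_int (r j) * t ^ j)"
  proof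
    fix i
    have "poly (of_int_poly (q * monom 1 i)) t = poly (of_int_poly q) t * t ^ i"
      by (simp add: hom_distribs poly_monom)
    then show "\<exists>r. poly (of_int_poly q) t * t ^ i = (\<Sum>j<D. of_int (r j) * t ^ j)"
      using red[of "q * monom 1 i"] by auto
  qed
  then obtain Q where Q: "\<And>i. poly (of_int_poly q) t * t ^ i = (\<Sum>j<D. of_int (Q i j) * t ^ j)"
    by metis
  obtain P where P: "poly P 0 = 1" "\<And>e. poly P e = det (one_add_mat D e Q)"
    using det_one_add_poly by blast
  have "of_int (det (one_add_mat D m Q)) = det (one_add_mat D (of_int m) (\<lambda>i j. of_int (Q i j) :: 'k))"
    unfolding of_int_hom.hom_det[symmetric]
    by (intro arg_cong[of _ _ det] eq_matI) (auto simp: one_add_mat_def)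
  also have "\<dots> = 0"
  \<comment> \<open>The null vector is (1, t, ..., t^(D-1)), nonzero because its entry 0 is
    1.\<close>
  proof (rule det_one_add_eq_0[of 0])
    fix i
    show "t ^ i + of_int m * (\<Sum>j<D. of_int (Q i j) * t ^ j) = 0"
      unfolding Q[symmetric] using arg_cong[OF z, of "\<lambda>u. u * t ^ i"] by (simp add: algebra_simps)
  qed (use D0 in auto)
  finally have "poly P m = 0" unfolding P by simp
  moreover have "m dvd poly P m - poly P 0"
    by (cases P) auto
  ultimately have "m dvd 1" using P(1) by simp
  with m show False by auto
qed

text \<open>The derivative has the form 1 + d q(t) with t integral and q an integer polynomial, so
  it cannot vanish for d \<ge> 2.\<close>

lemma center_poly_roots_simple:
  fixes t :: "'k::field_char_0"
  assumes "d \<ge> 2" "poly (center_poly d (Suc s)) t = 0"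
  shows "poly (pderiv (center_poly d (Suc s))) t \<noteq> 0"
proof -
  have hom: "of_int_poly (center_poly d s) = (center_poly d s :: 'k poly)" for s
  proof (induction s)
    case (Suc s)
    then show ?case by (simp add: center_poly_Suc hom_distribs)
  qed (simp add: center_poly_0)
  have "poly (pderiv (center_poly d (Suc s))) t =
    1 + of_int (int d) * poly (of_int_poly (center_poly d s ^ (d - 1) * pderiv (center_poly d s))) t"
    using assms(1) by (simp add: pderiv_center_poly hom hom_distribs of_int_hom.map_poly_pderiv[symmetric])
  also have "\<dots> \<noteq> 0"
    using assms center_poly_degree_monic[OF assms(1), where s = s and 'r = int]
    by (intro integral_not_inverse[of "center_poly d (Suc s)"]) (auto simp: hom)
  finally show ?thesis .
qed

lemma card_simple_roots:
  fixes p :: "'k::alg_closed_field poly"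
  assumes "\<And>t. poly p t = 0 \<Longrightarrow> poly (pderiv p) t \<noteq> 0"
  shows "card {t. poly p t = 0} \<ge> degree p"
  using assms
proof (induction "degree p" arbitrary: p)
  case (Suc m)
  then obtain t where t: "poly p t = 0" using alg_closed_imp_poly_has_root[of p] by auto
  then obtain q where q: "p = [:-t, 1:] * q" using poly_eq_0_iff_dvd by (metis dvdE)
  have p0: "p \<noteq> 0" and q0: "q \<noteq> 0" using Suc(2) q by auto
  have dq: "degree q = m"
    using Suc(2) degree_mult_eq[of "[:-t, 1:]" q] q0 unfolding q by (simp del: mult_pCons_left)
  have pd: "pderiv p = [:-t, 1:] * pderiv q + q" unfolding q pderiv_mult by (simp add: pderiv_pCons)
  have qt: "poly q t \<noteq> 0" using Suc(3)[OF t] pd by simp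
  have "poly (pderiv q) u \<noteq> 0" if u: "poly q u = 0" for u
    using Suc(3)[of u] pd u q by auto
  then have "m \<le> card {u. poly q u = 0}" using Suc(1)[of q] dq by auto
  moreover have "{u. poly p u = 0} = insert t {u. poly q u = 0}" by (auto simp: q)
  ultimately show ?case using qt poly_roots_finite[OF q0] Suc(2) by simp
qed simp

lemma infinite_centers:
  assumes "d \<ge> 2"
  shows "infinite {t :: 'k::{alg_closed_field, field_char_0}. \<exists>s. poly (center_poly d (Suc s)) t = 0}"
    (is "infinite ?R")
proof
  assume fin: "finite ?R"
  \<comment> \<open>If there were only m parameters in all, index m + 1 would already have too many
    distinct roots, namely d^m > m.\<close>
  define m where "m = card ?R"
  have "degree (center_poly d (Suc m) :: 'k poly) \<le> card {t :: 'k. poly (center_poly d (Suc m)) t = 0}"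
    using center_poly_roots_simple[OF assms] by (intro card_simple_roots)
  also have "\<dots> \<le> m" unfolding m_def by (intro card_mono fin) auto
  finally have "d ^ m \<le> m" using center_poly_degree_monic[OF assms, where s = m and 'r = 'k] by simp
  moreover have "m < 2 ^ m" by simp
  moreover have "2 ^ m \<le> d ^ m" using assms by (intro power_mono) auto
  ultimately show False by linarith
qed

section \<open>Polynomial functions over power series\<close>

no_notation vec_index (infixl \<open>$\<close> 100)
unbundle fps_syntax

text \<open>Polynomials in variables indexed by all naturals, kept as functions: only restriction to
  curves and congruences modulo powers of the series variable are needed.\<close>

inductive poly_fun :: "((nat \<Rightarrow> 'r::comm_ring_1) \<Rightarrow> 'r) \<Rightarrow> bool" where
  poly_fun_const: "poly_fun (\<lambda>x. c)"
| poly_fun_var: "poly_fun (\<lambda>x. x j)"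
| poly_fun_add: "poly_fun F \<Longrightarrow> poly_fun G \<Longrightarrow> poly_fun (\<lambda>x. F x + G x)"
| poly_fun_mult: "poly_fun F \<Longrightarrow> poly_fun G \<Longrightarrow> poly_fun (\<lambda>x. F x * G x)"

lemma poly_fun_sum: "(\<And>i. i \<in> I \<Longrightarrow> poly_fun (F i)) \<Longrightarrow> poly_fun (\<lambda>x. \<Sum>i\<in>I. F i x)"
  by (induction I rule: infinite_finite_induct) (auto intro: poly_fun.intros)

lemma poly_fun_prod: "(\<And>i. i \<in> I \<Longrightarrow> poly_fun (F i)) \<Longrightarrow> poly_fun (\<lambda>x. \<Prod>i\<in>I. F i x)"
  by (induction I rule: infinite_finite_induct) (auto intro: poly_fun.intros)

lemma poly_fun_power: "poly_fun F \<Longrightarrow> poly_fun (\<lambda>x. F x ^ m)"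
  by (induction m) (auto intro: poly_fun.intros)

lemma poly_fun_diff:
  assumes "poly_fun F" "poly_fun G"
  shows "poly_fun (\<lambda>x. F x - G x)"
proof -
  have "poly_fun (\<lambda>x. F x + (- 1) * G x)" using assms by (intro poly_fun.intros)
  then show ?thesis by simp
qed

lemma poly_fun_form_eval:
  assumes "\<And>l. poly_fun (\<lambda>x. g x l)"
  shows "poly_fun (\<lambda>x. form_eval n d c i (g x))"
  unfolding form_eval_def mono_eval_def
  by (intro poly_fun_sum poly_fun_mult poly_fun_const poly_fun_prod poly_fun_power assms)

lemma poly_fun_hpoly_eval:
  assumes "\<And>v. poly_fun (\<lambda>x. c x v)"
  shows "poly_fun (\<lambda>x. hpoly_eval n d B a (c x))"
  unfolding hpoly_eval_def by (intro poly_fun_sum poly_fun_mult poly_fun_const poly_fun_prod poly_fun_power assms)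

lemma poly_fun_poly:
  assumes "poly_fun F"
  shows "\<exists>P. \<forall>y. poly P y = F (\<lambda>j. poly (p j) y)"
  using assms
proof induction
  case (poly_fun_const c)
  show ?case by (intro exI[of _ "[:c:]"]) simp
next
  case (poly_fun_var j)
  show ?case by auto
next
  case (poly_fun_add F G)
  then show ?case by (metis poly_add)
next
  case (poly_fun_mult F G)
  then show ?case by (metis poly_mult)
qed

lemma poly_fun_cong_mod:
  fixes F :: "(nat \<Rightarrow> 'k::comm_ring_1 fps) \<Rightarrow> 'k fps"
  assumes "poly_fun F" "\<And>j i. i < m \<Longrightarrow> x j $ i = y j $ i" "i < m"
  shows "F x $ i = F y $ i"
  using assms(1,3)
proof (induction arbitrary: i)
  case (poly_fun_mult F G)
  then show ?case by (auto simp: fps_mult_nth intro!: sum.cong)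
qed (use assms in auto)

text \<open>Leibniz rule at the first order where the factors can change: each change meets only the
  constant term of the other factor.\<close>

lemma fps_mult_diff_nth:
  fixes A B :: "'k::comm_ring_1 fps"
  assumes "\<And>i. i < m \<Longrightarrow> A $ i = A' $ i" "\<And>i. i < m \<Longrightarrow> B $ i = B' $ i" "m \<ge> 1"
  shows "(A * B - A' * B') $ m = A $ 0 * (B - B') $ m + (A - A') $ m * B $ 0"
proof -
  have 1: "((A - A') * B) $ m = (A - A') $ m * B $ 0"
  proof -
    have "((A - A') * B) $ m = (\<Sum>i=0..m. if i = m then (A - A') $ m * B $ 0 else 0)"
      unfolding fps_mult_nth by (intro sum.cong) (auto simp: assms(1))
    then show ?thesis by simp
  qed
  have 2: "(A' * (B - B')) $ m = A' $ 0 * (B - B') $ m"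
  proof -
    have "(A' * (B - B')) $ m = (\<Sum>i=0..m. if i = 0 then A' $ 0 * (B - B') $ m else 0)"
      unfolding fps_mult_nth by (intro sum.cong) (auto simp: assms(2))
    then show ?thesis by simp
  qed
  have "A * B - A' * B' = (A - A') * B + A' * (B - B')" by (simp add: algebra_simps)
  then have "(A * B - A' * B') $ m = ((A - A') * B) $ m + (A' * (B - B')) $ m"
    by simp
  then show ?thesis unfolding 1 2 using assms(1)[of 0] assms(3) by simp
qed

lemma fps_power_diff_nth:
  fixes A :: "'k::comm_ring_1 fps"
  assumes "\<And>i. i < m \<Longrightarrow> A $ i = A' $ i" "m \<ge> 1"
  shows "(A ^ e - A' ^ e) $ m = of_nat e * (A $ 0) ^ (e - 1) * (A - A') $ m"
proof (induction e)
  case (Suc e)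
  have "A ^ e $ i = A' ^ e $ i" if "i < m" for i
    by (rule poly_fun_cong_mod[of "\<lambda>x. x 0 ^ e" m "\<lambda>_. A" "\<lambda>_. A'"])
       (use assms that in \<open>auto intro: poly_fun_power poly_fun_var\<close>)
  from fps_mult_diff_nth[OF assms(1) this assms(2)]
  have "(A ^ Suc e - A' ^ Suc e) $ m = A $ 0 * (A ^ e - A' ^ e) $ m + (A - A') $ m * (A $ 0) ^ e"
    by (simp add: fps_nth_power_0)
  also have "\<dots> = of_nat (Suc e) * (A $ 0) ^ (Suc e - 1) * (A - A') $ m"
    unfolding Suc by (cases e) (simp_all add: algebra_simps)
  finally show ?case .
qed simp

text \<open>Modulo the series variable, \<Phi> has the diagonal derivative D, expressed by
  \<open>diff\<close>. Hence the coefficients of T can be solved for one order at a time and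
  separately for each j.\<close>

lemma fps_hensel:
  fixes \<Phi> :: "(nat \<Rightarrow> 'k::field fps) \<Rightarrow> nat \<Rightarrow> 'k fps" and t D :: "nat \<Rightarrow> 'k"
  assumes D: "\<And>j. j \<in> J \<Longrightarrow> D j \<noteq> 0"
    and root: "\<And>j. j \<in> J \<Longrightarrow> \<Phi> (\<lambda>j. fps_const (t j)) j $ 0 = 0"
    and cong0: "\<And>T T' j. j \<in> J \<Longrightarrow> (\<And>j. T j $ 0 = t j) \<Longrightarrow> (\<And>j. T' j $ 0 = t j) \<Longrightarrow>
       \<Phi> T j $ 0 = \<Phi> T' j $ 0"
    and diff: "\<And>m T T' j. m \<ge> 1 \<Longrightarrow> (\<And>j. T j $ 0 = t j) \<Longrightarrow>
       (\<And>j i. i < m \<Longrightarrow> T j $ i = T' j $ i) \<Longrightarrow> j \<in> J \<Longrightarrow>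
       (\<Phi> T j - \<Phi> T' j) $ m = D j * (T j - T' j) $ m"
  obtains T where "\<And>j. T j $ 0 = t j" "\<And>j. j \<in> J \<Longrightarrow> \<Phi> T j = 0"
proof -
  \<comment> \<open>Newton step at order k + 1: subtracting the error coefficient divided by
    \<open>D j\<close> leaves lower orders untouched. Components outside J stay constant.\<close>
  define S where "S = rec_nat (\<lambda>j. fps_const (t j))
    (\<lambda>k T j. T j - (if j \<in> J then fps_const (\<Phi> T j $ Suc k / D j) * fps_X ^ Suc k else 0))"
  have S0: "S 0 = (\<lambda>j. fps_const (t j))"
    and SS: "S (Suc k) j = S k j - (if j \<in> J then fps_const (\<Phi> (S k) j $ Suc k / D j) * fps_X ^ Suc k else 0)"
    for k j by (simp_all add: S_def)
  have step: "S (Suc k) j $ i = S k j $ i" if "i \<le> k" for i j k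
    using that by (auto simp: SS fps_X_power_nth)
  have stab: "S k j $ i = S m j $ i" if "m \<le> k" "i \<le> m" for i j k m
    using that by (induction k) (auto simp: le_Suc_eq step)
  have S_0: "S k j $ 0 = t j" for k j
    using stab[of 0 k 0 j] S0 by simp
  have cong: "\<Phi> A j $ i = \<Phi> A' j $ i"
    if j: "j \<in> J" and A: "\<And>j. A j $ 0 = t j" and eq: "\<And>j i. i \<le> m \<Longrightarrow> A j $ i = A' j $ i" and i: "i \<le> m"
    for A A' j m i
  proof (cases "i = 0")
    case True
    have "A' j $ 0 = t j" for j using A[of j] eq[of 0 j] by simp
    with cong0[OF j A] True show ?thesis by simp
  next
    case False
    have "(\<Phi> A j - \<Phi> A' j) $ i = D j * (A j - A' j) $ i"
      using False i A j eq by (intro diff) auto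
    then show ?thesis using eq[OF i] by simp
  qed
  have zero: "\<Phi> (S k) j $ i = 0" if j: "j \<in> J" and "i \<le> k" for j k i
    using that(2)
  proof (induction k arbitrary: i)
    case 0
    then show ?case using root[OF j] S0 by simp
  next
    case (Suc k)
    have old: "\<Phi> (S (Suc k)) j $ i = \<Phi> (S k) j $ i" if "i \<le> k" for i
      using that j S_0 step by (intro cong[of j _ k]) auto
    have "(\<Phi> (S (Suc k)) j - \<Phi> (S k) j) $ Suc k = D j * (S (Suc k) j - S k j) $ Suc k"
      by (rule diff) (use S_0 step j in auto)
    also have "\<dots> = - \<Phi> (S k) j $ Suc k" using j D[OF j] by (simp add: SS)
    finally have "\<Phi> (S (Suc k)) j $ Suc k = 0" by (simp add: algebra_simps)
    then show ?case using Suc old by (cases "i = Suc k") auto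
  qed
  \<comment> \<open>Coefficient i no longer changes after stage i, so the diagonal is the
    limit.\<close>
  define T where "T j = Abs_fps (\<lambda>i. S i j $ i)" for j
  have TS: "T j $ i = S k j $ i" if "i \<le> k" for i j k
    using stab[OF that, of i] by (simp add: T_def)
  have T0: "T j $ 0 = t j" for j using S_0 by (simp add: T_def)
  have "\<Phi> T j = 0" if j: "j \<in> J" for j
  proof (rule fps_ext)
    fix i
    have "\<Phi> T j $ i = \<Phi> (S i) j $ i"
      using j T0 TS by (intro cong[of j _ i]) auto
    then show "\<Phi> T j $ i = 0 $ i" using zero[OF j] by simp
  qed
  with T0 show thesis by (rule that)
qed

lemma fps_const_sum: "fps_const (sum f I) = (\<Sum>i\<in>I. fps_const (f i))"
  by (induction I rule: infinite_finite_induct) (simp_all flip: fps_const_add)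

text \<open>Extracting one series coefficient commutes with evaluation at constants, which turns
  questions over k[[\<epsilon>]] into root counts over k.\<close>

definition slice :: "nat \<Rightarrow> 'k::comm_ring_1 fps poly \<Rightarrow> 'k poly" where
  "slice i P = map_poly (\<lambda>c. c $ i) P"

lemma slice_0: "slice i 0 = 0"
  by (simp add: slice_def)

lemma slice_pCons: "slice i (pCons a P) = pCons (a $ i) (slice i P)"
  by (simp add: slice_def poly_eq_iff coeff_map_poly coeff_pCons split: nat.splits)

lemma poly_slice: "poly (slice i P) e = poly P (fps_const e) $ i"
  by (induction P) (simp_all add: slice_0 slice_pCons)

text \<open>Replace T by its truncation with the variable of the series renamed to \<eta>. The coefficients
  below m vanish for all constant values of \<eta>, hence identically, and the substitution of the
  series variable for \<eta> can only contribute at order m through \<eta> = 0.\<close>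

lemma poly_fun_leading_coeff:
  fixes F :: "(nat \<Rightarrow> 'k::field_char_0 fps) \<Rightarrow> 'k fps"
  assumes F: "poly_fun F" and low: "\<And>t i. i < m \<Longrightarrow> F (\<lambda>j. fps_const (t j)) $ i = 0"
  shows "F T $ m = F (\<lambda>j. fps_const (T j $ 0)) $ m"
proof -
  define p where "p j = (\<Sum>i\<le>m. monom (fps_const (T j $ i)) i)" for j
  have p_ev: "poly (p j) y = (\<Sum>i\<le>m. fps_const (T j $ i) * y ^ i)" for j y
    by (simp add: p_def poly_sum poly_monom)
  obtain P where P: "\<And>y. poly P y = F (\<lambda>j. poly (p j) y)" using poly_fun_poly[OF F, of p] by blast
  have "coeff P l $ i = 0" if "i < m" for i l
  proof -
    have "poly (slice i P) e = 0" for e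
    proof -
      have "poly (p j) (fps_const e) = fps_const (\<Sum>i\<le>m. T j $ i * e ^ i)" for j
        unfolding p_ev by (simp add: fps_const_power fps_const_sum flip: fps_const_mult)
      then show ?thesis unfolding poly_slice P using low[OF that] by simp
    qed
    then have "slice i P = 0" using poly_all_0_iff_0 by blast
    then have "coeff (slice i P) l = 0" by simp
    then show ?thesis by (simp add: slice_def coeff_map_poly)
  qed
  note coeffs = this
  have "F T $ m = F (\<lambda>j. poly (p j) fps_X) $ m"
  proof (rule poly_fun_cong_mod[OF F, of "Suc m"])
    fix j i assume i: "i < Suc m"
    have "poly (p j) fps_X $ i = (\<Sum>l\<le>m. if l = i then T j $ l else 0)"
      unfolding p_ev fps_sum_nth by (intro sum.cong) (auto simp: fps_X_power_nth)
    then show "T j $ i = poly (p j) fps_X $ i" using i by simp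
  qed simp
  also have "\<dots> = poly P fps_X $ m" by (simp add: P)
  also have "\<dots> = (\<Sum>l\<le>degree P. if l = 0 then coeff P 0 $ m else 0)"
    unfolding poly_altdef fps_sum_nth
  proof (intro sum.cong refl)
    fix l
    show "(coeff P l * fps_X ^ l) $ m = (if l = 0 then coeff P 0 $ m else 0)"
      using coeffs[of "m - l" l] by (cases "l = 0") (auto simp: fps_X_power_mult_right_nth)
  qed
  also have "\<dots> = poly P 0 $ m" by (simp add: poly_0_coeff_0)
  also have "\<dots> = F (\<lambda>j. fps_const (T j $ 0)) $ m"
  proof -
    have "poly (p j) 0 = fps_const (T j $ 0)" for j
    proof -
      have "poly (p j) 0 = (\<Sum>i\<le>m. if i = 0 then fps_const (T j $ 0) else 0)"
        unfolding p_ev by (intro sum.cong) auto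
      then show ?thesis by simp
    qed
    then show ?thesis by (simp add: P)
  qed
  finally show ?thesis .
qed

text \<open>Coordinates are moved into R one at a time: along each of them coefficient m of F is a
  nonzero polynomial over k, with finitely many roots.\<close>

lemma poly_fun_nonzero_on_infinite:
  fixes F :: "(nat \<Rightarrow> 'k::field_char_0 fps) \<Rightarrow> 'k fps"
  assumes F: "poly_fun F" and J: "finite J" and R: "infinite R" and nz: "F (\<lambda>j. fps_const (t j)) $ m \<noteq> 0"
  shows "\<exists>t. (\<forall>j\<in>J. t j \<in> R) \<and> F (\<lambda>j. fps_const (t j)) $ m \<noteq> 0"
  using J
proof (induction J)
  case empty
  then show ?case using nz by auto
next
  case (insert j J)
  then obtain t where t: "\<forall>j\<in>J. t j \<in> R" "F (\<lambda>j. fps_const (t j)) $ m \<noteq> 0" by auto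
  define p where "p l = (if l = j then [:0, 1:] else [:fps_const (t l):])" for l
  have p: "(\<lambda>l. poly (p l) (fps_const e)) = (\<lambda>l. fps_const ((t(j := e)) l))" for e
    by (auto simp: p_def)
  obtain P where P: "\<And>y. poly P y = F (\<lambda>j. poly (p j) y)" using poly_fun_poly[OF F, of p] by blast
  have ev: "poly (slice m P) e = F (\<lambda>l. fps_const ((t(j := e)) l)) $ m" for e
    unfolding poly_slice P p ..
  have "poly (slice m P) (t j) \<noteq> 0" unfolding ev using t by simp
  then have "slice m P \<noteq> 0" by auto
  then have "finite {e. poly (slice m P) e = 0}" by (rule poly_roots_finite)
  then obtain e where "e \<in> R" "poly (slice m P) e \<noteq> 0"
    using R by (metis (mono_tags, lifting) finite_subset mem_Collect_eq subsetI)
  then show ?case using t insert(2) unfolding ev by (intro exI[of _ "t(j := e)"]) auto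
qed

section \<open>Forms\<close>

lemma finite_deg_monos: "finite (deg_monos n d)"
proof (rule finite_subset)
  show "deg_monos n d \<subseteq> {\<alpha>. set \<alpha> \<subseteq> {..d} \<and> length \<alpha> = n + 1}"
    by (auto simp: deg_monos_def dest: member_le_sum_list)
qed (rule finite_lists_length_eq, simp)

lemma sum_nth_deg_monos: "\<alpha> \<in> deg_monos n d \<Longrightarrow> (\<Sum>l\<le>n. \<alpha> ! l) = d"
  by (auto simp: deg_monos_def sum_list_sum_nth lessThan_atLeast0[symmetric] lessThan_Suc_atMost)

lemma deg_monosI: "length \<alpha> = n + 1 \<Longrightarrow> (\<Sum>l\<le>n. \<alpha> ! l) = d \<Longrightarrow> \<alpha> \<in> deg_monos n d"
  by (auto simp: deg_monos_def sum_list_sum_nth lessThan_atLeast0[symmetric] lessThan_Suc_atMost)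

lemma mono_eval_add:
  assumes "length \<alpha> = n + 1" "length \<beta> = n + 1"
  shows "mono_eval n (map2 (+) \<alpha> \<beta>) x = mono_eval n \<alpha> x * mono_eval n \<beta> x"
  unfolding mono_eval_def using assms by (auto simp: power_add prod.distrib[symmetric] intro!: prod.cong)

lemma map2_add_deg_monos:
  assumes "\<alpha> \<in> deg_monos n d" "\<beta> \<in> deg_monos n e"
  shows "map2 (+) \<alpha> \<beta> \<in> deg_monos n (d + e)"
proof (rule deg_monosI)
  have "(\<Sum>l\<le>n. map2 (+) \<alpha> \<beta> ! l) = (\<Sum>l\<le>n. \<alpha> ! l + \<beta> ! l)"
    using assms by (intro sum.cong) (auto simp: deg_monos_def)
  then show "(\<Sum>l\<le>n. map2 (+) \<alpha> \<beta> ! l) = d + e"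
    using assms by (simp add: sum.distrib sum_nth_deg_monos)
qed (use assms in \<open>auto simp: deg_monos_def\<close>)

lemma hom_on_fps_const: "hom_on UNIV fps_const"
  by (auto simp: hom_on_def is_subring_def)

lemmas fps_const_mono_eval = hom_on_mono_eval(2)[OF hom_on_fps_const, OF UNIV_I]
lemmas fps_const_form_eval = hom_on_form_eval(2)[OF hom_on_fps_const, OF UNIV_I UNIV_I]

text \<open>Coefficients are constant but arguments are series: the same form can be evaluated at
  constants, along orbits, and at x + \<epsilon> w to read off derivatives.\<close>

definition isform :: "nat \<Rightarrow> nat \<Rightarrow> ((nat \<Rightarrow> 'k::comm_ring_1 fps) \<Rightarrow> 'k fps) \<Rightarrow> bool" where
  "isform n d F \<longleftrightarrow> (\<exists>q. \<forall>x. F x = (\<Sum>\<alpha>\<in>deg_monos n d. fps_const (q \<alpha>) * mono_eval n \<alpha> x))"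

lemma isform_mono:
  assumes "\<alpha> \<in> deg_monos n d"
  shows "isform n d (mono_eval n \<alpha>)"
  unfolding isform_def
proof (intro exI[of _ "\<lambda>\<beta>. if \<beta> = \<alpha> then 1 else 0"] allI)
  fix x :: "nat \<Rightarrow> 'a fps"
  have "(\<Sum>\<beta>\<in>deg_monos n d. fps_const (if \<beta> = \<alpha> then 1 else 0) * mono_eval n \<beta> x) =
    (\<Sum>\<beta>\<in>deg_monos n d. if \<beta> = \<alpha> then mono_eval n \<beta> x else 0)" by (intro sum.cong) auto
  then show "mono_eval n \<alpha> x = (\<Sum>\<beta>\<in>deg_monos n d. fps_const (if \<beta> = \<alpha> then 1 else 0) * mono_eval n \<beta> x)"
    using assms by (simp add: finite_deg_monos)
qed

lemma isform_cmult:
  assumes "isform n d F"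
  shows "isform n d (\<lambda>x. fps_const a * F x)"
proof -
  obtain q where "\<And>x. F x = (\<Sum>\<alpha>\<in>deg_monos n d. fps_const (q \<alpha>) * mono_eval n \<alpha> x)"
    using assms by (auto simp: isform_def)
  then show ?thesis
    unfolding isform_def
    by (intro exI[of _ "\<lambda>\<alpha>. a * q \<alpha>"]) (simp add: sum_distrib_left mult.assoc flip: fps_const_mult)
qed

lemma isform_sum:
  assumes "\<And>i. i \<in> I \<Longrightarrow> isform n d (F i)"
  shows "isform n d (\<lambda>x. \<Sum>i\<in>I. F i x)"
proof -
  obtain q where "\<And>i x. i \<in> I \<Longrightarrow> F i x = (\<Sum>\<alpha>\<in>deg_monos n d. fps_const (q i \<alpha>) * mono_eval n \<alpha> x)"
    using assms unfolding isform_def by metis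
  then show ?thesis
    unfolding isform_def
    by (intro exI[of _ "\<lambda>\<alpha>. \<Sum>i\<in>I. q i \<alpha>"])
       (simp add: fps_const_sum sum_distrib_right sum.swap[of _ I])
qed

lemma isform_diff:
  assumes "isform n d F" "isform n d G"
  shows "isform n d (\<lambda>x. F x - G x)"
proof -
  have "isform n d (\<lambda>x. if i = 0 then F x else fps_const (- 1) * G x)" for i :: nat
    using assms(1) isform_cmult[OF assms(2)] by (cases "i = 0") auto
  then have "isform n d (\<lambda>x. \<Sum>i<2. if i = (0::nat) then F x else fps_const (- 1) * G x)"
    by (intro isform_sum)
  then show ?thesis by (simp add: numeral_2_eq_2 flip: fps_const_neg)
qed

lemma isform_mult:
  assumes "isform n d F" "isform n e G"
  shows "isform n (d + e) (\<lambda>x. F x * G x)"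
proof -
  obtain p q where p: "\<And>x. F x = (\<Sum>\<alpha>\<in>deg_monos n d. fps_const (p \<alpha>) * mono_eval n \<alpha> x)"
    and q: "\<And>x. G x = (\<Sum>\<alpha>\<in>deg_monos n e. fps_const (q \<alpha>) * mono_eval n \<alpha> x)"
    using assms unfolding isform_def by auto
  have "F x * G x = (\<Sum>\<alpha>\<in>deg_monos n d. \<Sum>\<beta>\<in>deg_monos n e.
      fps_const (p \<alpha> * q \<beta>) * mono_eval n (map2 (+) \<alpha> \<beta>) x)" for x
    unfolding p q sum_product
    by (intro sum.cong refl) (simp add: mono_eval_add deg_monos_def mult_ac flip: fps_const_mult)
  moreover have "isform n (d + e) (\<lambda>x. \<Sum>\<alpha>\<in>deg_monos n d. \<Sum>\<beta>\<in>deg_monos n e.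
      fps_const (p \<alpha> * q \<beta>) * mono_eval n (map2 (+) \<alpha> \<beta>) x)"
    by (intro isform_sum isform_cmult isform_mono map2_add_deg_monos)
  ultimately show ?thesis by simp
qed

lemma isform_one: "isform n 0 (\<lambda>x. 1)"
proof -
  have "replicate (n + 1) 0 \<in> deg_monos n 0" by (auto simp: deg_monos_def sum_list_replicate)
  from isform_mono[OF this] show ?thesis
    by (rule back_subst[of "isform n 0"]) (auto simp: mono_eval_def fun_eq_iff simp del: replicate.simps)
qed

lemma isform_var:
  assumes "j \<le> n"
  shows "isform n 1 (\<lambda>x. x j)"
proof -
  define \<alpha> where "\<alpha> = map (\<lambda>l. if l = j then 1 else 0 :: nat) [0..<n + 1]"
  have nth: "\<alpha> ! l = (if l = j then 1 else 0)" if "l \<le> n" for l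
    using that by (simp add: \<alpha>_def del: upt_Suc)
  have "\<alpha> \<in> deg_monos n 1"
    using assms by (intro deg_monosI) (simp_all add: nth, simp add: \<alpha>_def)
  moreover have "mono_eval n \<alpha> = (\<lambda>x :: nat \<Rightarrow> 'a fps. x j)"
  proof
    fix x :: "nat \<Rightarrow> 'a fps"
    have "mono_eval n \<alpha> x = (\<Prod>l\<le>n. if l = j then x l else 1)"
      unfolding mono_eval_def by (intro prod.cong) (auto simp: nth)
    then show "mono_eval n \<alpha> x = x j" using assms by simp
  qed
  ultimately show ?thesis using isform_mono[of \<alpha> n 1] by metis
qed

lemma isform_power: "isform n d F \<Longrightarrow> isform n (m * d) (\<lambda>x. F x ^ m)"
  by (induction m) (auto intro: isform_one isform_mult)

lemma isform_prod:
  assumes "finite I" "\<And>i. i \<in> I \<Longrightarrow> isform n (e i) (F i)"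
  shows "isform n (\<Sum>i\<in>I. e i) (\<lambda>x. \<Prod>i\<in>I. F i x)"
  using assms by (induction I) (auto intro: isform_one isform_mult)

definition lin :: "nat \<Rightarrow> (nat \<Rightarrow> nat \<Rightarrow> 'k::comm_ring_1) \<Rightarrow> (nat \<Rightarrow> 'k) \<Rightarrow> nat \<Rightarrow> 'k" where
  "lin n A x i = (\<Sum>j\<le>n. A i j * x j)"

abbreviation clin :: "nat \<Rightarrow> (nat \<Rightarrow> nat \<Rightarrow> 'k::comm_ring_1) \<Rightarrow> (nat \<Rightarrow> 'k fps) \<Rightarrow> nat \<Rightarrow> 'k fps" where
  "clin n A \<equiv> lin n (\<lambda>i j. fps_const (A i j))"

lemma isform_lin: "isform n 1 (\<lambda>x. clin n A x i)"
  unfolding lin_def by (intro isform_sum isform_cmult isform_var) auto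

lemma isform_form_eval_lin: "isform n d (\<lambda>x. form_eval n d (\<lambda>v. fps_const (c v)) i (clin n A x))"
  unfolding form_eval_def
proof (intro isform_sum isform_cmult)
  fix \<alpha> assume \<alpha>: "\<alpha> \<in> deg_monos n d"
  have "isform n (\<Sum>l\<le>n. \<alpha> ! l * 1) (\<lambda>x. mono_eval n \<alpha> (clin n A x))"
    unfolding mono_eval_def by (intro isform_prod isform_power isform_lin) auto
  then show "isform n d (\<lambda>x. mono_eval n \<alpha> (clin n A x))"
    using \<alpha> by (simp add: sum_nth_deg_monos)
qed

text \<open>The way back from functions to coefficient vectors; it makes the power map in new
  coordinates a point of the coefficient space.\<close>

lemma isform_eq_form_eval:
  assumes "\<And>i. i \<le> n \<Longrightarrow> isform n d (F i)"
  obtains c where "\<And>v. v \<notin> coeff_idx n d \<Longrightarrow> c v = 0"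
    "\<And>i x. i \<le> n \<Longrightarrow> form_eval n d (\<lambda>v. fps_const (c v)) i x = F i x"
proof -
  obtain q where q: "\<And>i x. i \<le> n \<Longrightarrow> F i x = (\<Sum>\<alpha>\<in>deg_monos n d. fps_const (q i \<alpha>) * mono_eval n \<alpha> x)"
    using assms unfolding isform_def by metis
  define c where "c v = (if v \<in> coeff_idx n d then q (fst v) (snd v) else 0)" for v
  have "form_eval n d (\<lambda>v. fps_const (c v)) i x = F i x" if "i \<le> n" for i x
    unfolding form_eval_def q[OF that]
    by (intro sum.cong refl) (use that in \<open>auto simp: c_def coeff_idx_def\<close>)
  then show thesis using that[of c] by (auto simp: c_def)
qed

text \<open>Every monomial of degree N = (n+1)d is divisible by some x_j^d, so a common zero of the forms
  x_j^d + e \<delta>_j turns the vector of all monomials of degree N into a null vector of 1 + e M, with M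
  independent of e (a Macaulay matrix).\<close>

lemma finite_degenerate_parameters:
  fixes \<delta> :: "nat \<Rightarrow> (nat \<Rightarrow> 'k::field fps) \<Rightarrow> 'k fps"
  assumes \<delta>: "\<And>j. j \<le> n \<Longrightarrow> isform n d (\<delta> j)"
  shows "finite {e. \<exists>y. nontrivial n y \<and>
    (\<forall>j\<le>n. fps_const (y j) ^ d + fps_const e * \<delta> j (\<lambda>l. fps_const (y l)) = 0)}"
proof -
  define N where "N = (n + 1) * d"
  let ?I = "deg_monos n N"
  define Z where "Z e y \<longleftrightarrow> (\<forall>j\<le>n. fps_const (y j) ^ d + fps_const e * \<delta> j (\<lambda>l. fps_const (y l)) = 0)"
    for e and y :: "nat \<Rightarrow> 'k"
  have "\<exists>M. \<forall>e y. Z e y \<longrightarrow> mono_eval n \<gamma> y + e * (\<Sum>\<beta>\<in>?I. M \<beta> * mono_eval n \<beta> y) = 0"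
    if \<gamma>: "\<gamma> \<in> ?I" for \<gamma>
  proof -
    have "\<exists>j\<le>n. \<gamma> ! j \<ge> d"
    proof (rule ccontr)
      assume "\<not> (\<exists>j\<le>n. \<gamma> ! j \<ge> d)"
      then have "(\<Sum>l\<le>n. \<gamma> ! l) < (\<Sum>l\<le>n. d)" by (intro sum_strict_mono) auto
      then show False using sum_nth_deg_monos[OF \<gamma>] by (simp add: N_def)
    qed
    then obtain j where j: "j \<le> n" "\<gamma> ! j \<ge> d" by auto
    have len: "length \<gamma> = n + 1" using \<gamma> by (simp add: deg_monos_def)
    define \<gamma>' where "\<gamma>' = \<gamma>[j := \<gamma> ! j - d]"
    have nth': "\<gamma>' ! l = (if l = j then \<gamma> ! j - d else \<gamma> ! l)" if "l \<le> n" for l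
      using that len by (simp add: \<gamma>'_def nth_list_update)
    have "(\<Sum>l\<le>n. \<gamma> ! l) = (\<Sum>l\<le>n. \<gamma>' ! l + (if l = j then d else 0))"
      using j by (intro sum.cong) (auto simp: nth')
    then have "N = (\<Sum>l\<le>n. \<gamma>' ! l) + d"
      using sum_nth_deg_monos[OF \<gamma>] j by (simp add: sum.distrib)
    then have \<gamma>': "\<gamma>' \<in> deg_monos n (N - d)" and N: "N = N - d + d"
      using len by (auto intro!: deg_monosI simp: \<gamma>'_def)
    have split: "mono_eval n \<gamma> x = mono_eval n \<gamma>' x * x j ^ d" for x :: "nat \<Rightarrow> 'k fps"
    proof -
      have "mono_eval n \<gamma> x = (\<Prod>l\<le>n. x l ^ (\<gamma>' ! l) * (if l = j then x l ^ d else 1))"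
        unfolding mono_eval_def using j by (intro prod.cong) (auto simp: nth' simp flip: power_add)
      then show ?thesis using j by (simp add: prod.distrib mono_eval_def)
    qed
    \<comment> \<open>The matrix row comes from expanding the cofactor times
      \<open>\<delta> j\<close>; neither involves e or the common zero.\<close>
    have "isform n N (\<lambda>x. mono_eval n \<gamma>' x * \<delta> j x)"
      using isform_mult[OF isform_mono[OF \<gamma>'] \<delta>[OF j(1)]] N by simp
    then obtain M where M: "\<And>x. mono_eval n \<gamma>' x * \<delta> j x = (\<Sum>\<alpha>\<in>?I. fps_const (M \<alpha>) * mono_eval n \<alpha> x)"
      by (auto simp: isform_def)
    show ?thesis
    proof (intro exI[of _ M] allI impI)
      fix e y assume z: "Z e y"
      have "fps_const (mono_eval n \<gamma> y + e * (\<Sum>\<beta>\<in>?I. M \<beta> * mono_eval n \<beta> y)) =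
        mono_eval n \<gamma> (\<lambda>l. fps_const (y l)) +
        fps_const e * (\<Sum>\<alpha>\<in>?I. fps_const (M \<alpha>) * mono_eval n \<alpha> (\<lambda>l. fps_const (y l)))"
        by (simp add: fps_const_sum fps_const_mono_eval flip: fps_const_add fps_const_mult)
      also have "\<dots> = mono_eval n \<gamma>' (\<lambda>l. fps_const (y l)) *
        (fps_const (y j) ^ d + fps_const e * \<delta> j (\<lambda>l. fps_const (y l)))"
        unfolding split M[symmetric] by (simp add: algebra_simps)
      also have "\<dots> = 0" using z j by (simp add: Z_def)
      finally show "mono_eval n \<gamma> y + e * (\<Sum>\<beta>\<in>?I. M \<beta> * mono_eval n \<beta> y) = 0" by simp
    qed
  qed
  then have "\<forall>\<gamma>\<in>?I. \<exists>M. \<forall>e y. Z e y \<longrightarrow> mono_eval n \<gamma> y + e * (\<Sum>\<beta>\<in>?I. M \<beta> * mono_eval n \<beta> y) = 0"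
    by blast
  from bchoice[OF this] obtain M where M: "\<And>\<gamma> e y. \<gamma> \<in> ?I \<Longrightarrow> Z e y \<Longrightarrow>
      mono_eval n \<gamma> y + e * (\<Sum>\<beta>\<in>?I. M \<gamma> \<beta> * mono_eval n \<beta> y) = 0"
    by blast
  have nz: "\<exists>\<gamma>\<in>?I. mono_eval n \<gamma> y \<noteq> 0" if y: "nontrivial n y" for y :: "nat \<Rightarrow> 'k"
  proof -
    obtain j where j: "j \<le> n" "y j \<noteq> 0" using y by (auto simp: nontrivial_def)
    define \<gamma> where "\<gamma> = map (\<lambda>l. if l = j then N else 0) [0..<n + 1]"
    have nth: "\<gamma> ! l = (if l = j then N else 0)" if "l \<le> n" for l
      using that by (simp add: \<gamma>_def del: upt_Suc)
    have "\<gamma> \<in> ?I" using j by (intro deg_monosI) (simp_all add: nth, simp add: \<gamma>_def)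
    moreover have "mono_eval n \<gamma> y \<noteq> 0" using j by (auto simp: mono_eval_def nth)
    ultimately show ?thesis by blast
  qed
  show ?thesis
  proof (rule finite_subset[OF _ finite_inverse_eigenvalues[OF finite_deg_monos, of n N M]], safe)
    fix e y assume y: "nontrivial n y"
      "\<forall>j\<le>n. fps_const (y j) ^ d + fps_const e * \<delta> j (\<lambda>l. fps_const (y l)) = 0"
    then have "Z e y" by (simp add: Z_def)
    show "\<exists>v. (\<exists>i\<in>?I. v i \<noteq> 0) \<and> (\<forall>i\<in>?I. v i + e * (\<Sum>j\<in>?I. M i j * v j) = 0)"
      using nz[OF y(1)] M[OF _ \<open>Z e y\<close>] by (intro exI[of _ "\<lambda>\<gamma>. mono_eval n \<gamma> y"]) auto
  qed
qed

section \<open>Critical points\<close>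

lemma fps_prod_nth_0: "(\<Prod>l\<in>I. f l) $ 0 = (\<Prod>l\<in>I. f l $ 0 :: 'k::comm_ring_1)"
  by (induction I rule: infinite_finite_induct) auto

lemma fps_prod_nth_1:
  fixes f :: "'a \<Rightarrow> 'k::comm_ring_1 fps"
  assumes "finite I"
  shows "(\<Prod>l\<in>I. f l) $ 1 = (\<Sum>j\<in>I. f j $ 1 * (\<Prod>l\<in>I - {j}. f l $ 0))"
  using assms
proof (induction I)
  case (insert i I)
  have "(\<Prod>l\<in>insert i I. f l) $ 1 = f i $ 0 * (\<Prod>l\<in>I. f l) $ 1 + f i $ 1 * (\<Prod>l\<in>I. f l $ 0)"
    using insert(1,2) by (simp add: fps_mult_nth_1 fps_prod_nth_0)
  also have "f i $ 0 * (\<Prod>l\<in>I. f l) $ 1 = (\<Sum>j\<in>I. f j $ 1 * (\<Prod>l\<in>insert i I - {j}. f l $ 0))"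
    unfolding insert.IH sum_distrib_left
  proof (intro sum.cong refl)
    fix j assume j: "j \<in> I"
    then have "insert i I - {j} = insert i (I - {j})" using insert(2) by auto
    then show "f i $ 0 * (f j $ 1 * (\<Prod>l\<in>I - {j}. f l $ 0)) = f j $ 1 * (\<Prod>l\<in>insert i I - {j}. f l $ 0)"
      using insert(1,2) by (simp add: mult_ac)
  qed
  also have "(\<Prod>l\<in>I. f l $ 0) = (\<Prod>l\<in>insert i I - {i}. f l $ 0)"
    using insert(2) by simp
  finally show ?case using insert(1,2) by (simp add: add.commute)
qed simp

lemma fps_power_nth_1: "(f ^ m) $ 1 = of_nat m * (f $ 0) ^ (m - 1) * f $ 1"
  for f :: "'k::comm_ring_1 fps"
  using fps_power_diff_nth[of 1 f "fps_const (f $ 0)" m] by simp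

lemma form_deriv_monomial:
  assumes "j \<le> n"
  shows "(\<Prod>l\<le>n. x l ^ (if l = j then \<alpha> ! l - 1 else \<alpha> ! l)) =
    x j ^ (\<alpha> ! j - 1) * (\<Prod>l\<in>{..n} - {j}. x l ^ (\<alpha> ! l) :: 'k::comm_ring_1)"
  using assms by (subst prod.remove[of _ j]) auto

text \<open>The derivative in direction w is the linear coefficient of f(x + \<epsilon> w), so
  criticality is tested by a power series computation and no chain rule is needed.\<close>

lemma form_eval_directional_derivative:
  fixes c :: "nat \<times> nat list \<Rightarrow> 'k::comm_ring_1"
  shows "form_eval n d (\<lambda>v. fps_const (c v)) i (\<lambda>l. fps_const (x l) + fps_X * fps_const (w l)) $ 1 =
    (\<Sum>j\<le>n. form_deriv_eval n d c i j x * w j)"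
proof -
  have mono: "mono_eval n \<alpha> (\<lambda>l. fps_const (x l) + fps_X * fps_const (w l)) $ 1 =
    (\<Sum>j\<le>n. of_nat (\<alpha> ! j) * (\<Prod>l\<le>n. x l ^ (if l = j then \<alpha> ! l - 1 else \<alpha> ! l)) * w j)" for \<alpha>
    unfolding mono_eval_def fps_prod_nth_1[OF finite_atMost]
    by (intro sum.cong refl) (simp add: form_deriv_monomial fps_power_nth_1[unfolded One_nat_def] fps_nth_power_0 mult_ac)
  have "form_eval n d (\<lambda>v. fps_const (c v)) i (\<lambda>l. fps_const (x l) + fps_X * fps_const (w l)) $ 1 =
    (\<Sum>\<alpha>\<in>deg_monos n d. c (i, \<alpha>) *
      (\<Sum>j\<le>n. of_nat (\<alpha> ! j) * (\<Prod>l\<le>n. x l ^ (if l = j then \<alpha> ! l - 1 else \<alpha> ! l)) * w j))"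
    unfolding form_eval_def fps_sum_nth by (simp only: fps_mult_left_const_nth mono)
  also have "\<dots> = (\<Sum>j\<le>n. form_deriv_eval n d c i j x * w j)"
    unfolding form_deriv_eval_def sum_distrib_left sum_distrib_right
    by (subst sum.swap) (simp add: mult_ac)
  finally show ?thesis .
qed

lemma euler_identity:
  "(\<Sum>j\<le>n. form_deriv_eval n d c i j x * x j) = of_nat d * form_eval n d c i x"
proof -
  have mono: "of_nat (\<alpha> ! j) * (\<Prod>l\<le>n. x l ^ (if l = j then \<alpha> ! l - 1 else \<alpha> ! l)) * x j =
    of_nat (\<alpha> ! j) * mono_eval n \<alpha> x" if "j \<le> n" for j \<alpha>
  proof (cases "\<alpha> ! j")
    case (Suc m)
    then show ?thesis
      using that unfolding form_deriv_monomial[OF that] mono_eval_def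
      by (subst (2) prod.remove[of _ j]) (auto simp: mult_ac)
  qed simp
  have "(\<Sum>j\<le>n. form_deriv_eval n d c i j x * x j) =
    (\<Sum>\<alpha>\<in>deg_monos n d. \<Sum>j\<le>n. c (i, \<alpha>) * (of_nat (\<alpha> ! j) * mono_eval n \<alpha> x))"
    unfolding form_deriv_eval_def sum_distrib_right
    by (subst sum.swap) (intro sum.cong refl, simp add: mono[symmetric] mult.assoc)
  also have "\<dots> = (\<Sum>\<alpha>\<in>deg_monos n d. c (i, \<alpha>) * (of_nat d * mono_eval n \<alpha> x))"
    by (intro sum.cong refl)
       (simp add: sum_nth_deg_monos flip: sum_distrib_left sum_distrib_right of_nat_sum)
  finally show ?thesis by (simp add: form_eval_def sum_distrib_left mult_ac)
qed

lemma form_deriv_homogeneous: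
  assumes "j \<le> n"
  shows "form_deriv_eval n d c i j (\<lambda>l. r * x l) = r ^ (d - 1) * form_deriv_eval n d c i j x"
  unfolding form_deriv_eval_def sum_distrib_left
proof (intro sum.cong refl)
  fix \<alpha> assume \<alpha>: "\<alpha> \<in> deg_monos n d"
  let ?e = "\<lambda>l. if l = j then \<alpha> ! l - 1 else \<alpha> ! l"
  show "c (i, \<alpha>) * of_nat (\<alpha> ! j) * (\<Prod>l\<le>n. (r * x l) ^ ?e l) =
    r ^ (d - 1) * (c (i, \<alpha>) * of_nat (\<alpha> ! j) * (\<Prod>l\<le>n. x l ^ ?e l))"
  proof (cases "\<alpha> ! j")
    case (Suc m)
    have "(\<Sum>l\<le>n. \<alpha> ! l) = (\<Sum>l\<le>n. ?e l + (if l = j then 1 else 0))"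
      using Suc by (intro sum.cong) auto
    then have "(\<Sum>l\<le>n. ?e l) = d - 1"
      using sum_nth_deg_monos[OF \<alpha>] assms by (simp add: sum.distrib)
    then have "(\<Prod>l\<le>n. (r * x l) ^ ?e l) = r ^ (d - 1) * (\<Prod>l\<le>n. x l ^ ?e l)"
      by (simp only: power_mult_distrib prod.distrib flip: power_sum)
    then show ?thesis by (simp add: mult_ac)
  qed simp
qed

lemma jac_eval_homogeneous:
  "jac_eval n d c (\<lambda>l. r * x l) = r ^ ((d - 1) * (n + 1)) * jac_eval n d c x"
proof -
  have "mat (n + 1) (n + 1) (\<lambda>(i, j). form_deriv_eval n d c i j (\<lambda>l. r * x l)) =
    r ^ (d - 1) \<cdot>\<^sub>m mat (n + 1) (n + 1) (\<lambda>(i, j). form_deriv_eval n d c i j x)"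
    by (rule eq_matI) (auto simp: form_deriv_homogeneous)
  then show ?thesis by (simp add: jac_eval_def power_mult del: mult_Suc_right power_Suc)
qed

lemma poly_fun_jac_eval: "poly_fun (\<lambda>x. jac_eval n d c x)"
proof -
  have "poly_fun (\<lambda>x. \<Sum>p | p permutes {0..<n + 1}. signof p *
      (\<Prod>i = 0..<n + 1. form_deriv_eval n d c i (p i) x))"
    unfolding form_deriv_eval_def
    by (intro poly_fun_sum poly_fun_mult poly_fun_const poly_fun_prod poly_fun_power poly_fun_var)
  moreover have "jac_eval n d c x = (\<Sum>p | p permutes {0..<n + 1}. signof p *
      (\<Prod>i = 0..<n + 1. form_deriv_eval n d c i (p i) x))" for x
    unfolding jac_eval_def
    by (subst det_def'[of _ "n + 1"]) (auto intro!: sum.cong prod.cong simp: permutes_in_image simp del: upt_Suc)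
  ultimately show ?thesis by simp
qed

text \<open>On the line spanned by the first two coordinate points the Jacobian is a binary form of
  positive degree.\<close>

lemma exists_critical_point:
  fixes c :: "nat \<times> nat list \<Rightarrow> 'k::{alg_closed_field, field_char_0}"
  assumes "n \<ge> 1" "d \<ge> 2"
  obtains P where "nontrivial n P" "jac_eval n d c P = 0"
proof -
  define u where "u x y = (\<lambda>j::nat. if j = 0 then x else if j = 1 then y else 0 :: 'k)" for x y
  have nt: "nontrivial n (u x y)" if "x \<noteq> 0 \<or> y \<noteq> 0" for x y
    using that assms unfolding nontrivial_def u_def by (auto intro: exI[of _ 0] exI[of _ 1])
  have poly_u: "(\<lambda>j. poly (if j = 0 then p else if j = 1 then q else 0) z) = u (poly p z) (poly q z)"
    for p q z by (auto simp: u_def)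
  obtain Q where Q: "\<And>x. poly Q x = jac_eval n d c (u x 1)"
    using poly_fun_poly[OF poly_fun_jac_eval[of n d c], of "\<lambda>j. if j = 0 then [:0, 1:] else if j = 1 then [:1:] else 0"]
    unfolding poly_u by auto
  obtain Q' where Q': "\<And>y. poly Q' y = jac_eval n d c (u 1 y)"
    using poly_fun_poly[OF poly_fun_jac_eval[of n d c], of "\<lambda>j. if j = 0 then [:1:] else if j = 1 then [:0, 1:] else 0"]
    unfolding poly_u by auto
  have "\<exists>x y. (x \<noteq> 0 \<or> y \<noteq> 0) \<and> jac_eval n d c (u x y) = 0"
  proof (cases "\<exists>x. poly Q x = 0")
    case True
    then show ?thesis using Q by (metis zero_neq_one)
  next
    case False
    then have "degree Q = 0" using alg_closed_imp_poly_has_root[of Q] by auto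
    then obtain q where q: "Q = [:q:]" using degree_eq_zeroE by blast
    define K where "K = (d - 1) * (n + 1)"
    have K: "K > 0" using assms by (simp add: K_def)
    \<comment> \<open>Away from y = 0 homogeneity gives Q'(y) = q y^K; the extra factor y covers y =
      0. Since K > 0, the Jacobian then vanishes at y = 0.\<close>
    have "poly ([:0, 1:] * (Q' - monom q K)) y = 0" for y
    proof (cases "y = 0")
      case False
      have "u 1 y = (\<lambda>l. y * u (1 / y) 1 l)" using False by (auto simp: u_def)
      then have "poly Q' y = y ^ K * poly Q (1 / y)"
        unfolding Q Q' K_def by (simp only: jac_eval_homogeneous)
      then show ?thesis by (simp add: q poly_monom)
    qed simp
    then have "[:0, 1:] * (Q' - monom q K) = 0" using poly_all_0_iff_0 by blast
    then have "Q' = monom q K" by (simp only: mult_eq_0_iff) auto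
    then have "jac_eval n d c (u 1 0) = 0" using Q'[of 0] K by (simp add: poly_monom zero_power)
    then show ?thesis by (metis zero_neq_one)
  qed
  then show thesis using nt that by blast
qed

lemma jac_eval_eq_0_iff:
  fixes c :: "nat \<times> nat list \<Rightarrow> 'k::field"
  shows "jac_eval n d c x = 0 \<longleftrightarrow>
    (\<exists>w. nontrivial n w \<and> (\<forall>i\<le>n. (\<Sum>j\<le>n. form_deriv_eval n d c i j x * w j) = 0))"
proof -
  define M where "M = mat (n + 1) (n + 1) (\<lambda>(i, j). form_deriv_eval n d c i j x)"
  have M: "M \<in> carrier_mat (n + 1) (n + 1)" by (simp add: M_def)
  have nth: "vec_index (M *\<^sub>v v) i = (\<Sum>j\<le>n. form_deriv_eval n d c i j x * vec_index v j)"
    if "v \<in> carrier_vec (n + 1)" "i \<le> n" for v i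
    using that by (auto simp: M_def scalar_prod_def lessThan_atLeast0[symmetric] lessThan_Suc_atMost intro!: sum.cong)
  have "jac_eval n d c x = 0 \<longleftrightarrow> (\<exists>v. v \<in> carrier_vec (n + 1) \<and> v \<noteq> 0\<^sub>v (n + 1) \<and> M *\<^sub>v v = 0\<^sub>v (n + 1))"
    unfolding jac_eval_def M_def[symmetric] by (rule det_0_iff_vec_prod_zero[OF M])
  also have "\<dots> \<longleftrightarrow> (\<exists>w. nontrivial n w \<and> (\<forall>i\<le>n. (\<Sum>j\<le>n. form_deriv_eval n d c i j x * w j) = 0))"
  proof safe
    fix v assume v: "v \<in> carrier_vec (n + 1)" "v \<noteq> 0\<^sub>v (n + 1)" "M *\<^sub>v v = 0\<^sub>v (n + 1)"
    have "nontrivial n (vec_index v)"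
      using v(1,2) by (auto simp: nontrivial_def vec_eq_iff less_Suc_eq_le)
    moreover have "(\<Sum>j\<le>n. form_deriv_eval n d c i j x * vec_index v j) = 0" if "i \<le> n" for i
      using nth[OF v(1) that] v(3) that by simp
    ultimately show "\<exists>w. nontrivial n w \<and> (\<forall>i\<le>n. (\<Sum>j\<le>n. form_deriv_eval n d c i j x * w j) = 0)"
      by blast
  next
    fix w assume w: "nontrivial n w" "\<forall>i\<le>n. (\<Sum>j\<le>n. form_deriv_eval n d c i j x * w j) = 0"
    let ?v = "vec (n + 1) w"
    have v: "?v \<in> carrier_vec (n + 1)" by simp
    have "M *\<^sub>v ?v = 0\<^sub>v (n + 1)"
    proof (rule eq_vecI)
      fix i assume "i < dim_vec (0\<^sub>v (n + 1) :: 'k vec)"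
      then have i: "i \<le> n" by simp
      have "vec_index (M *\<^sub>v ?v) i = (\<Sum>j\<le>n. form_deriv_eval n d c i j x * w j)"
        unfolding nth[OF v i] by (intro sum.cong) auto
      then show "vec_index (M *\<^sub>v ?v) i = vec_index (0\<^sub>v (n + 1)) i" using w i by simp
    qed (simp add: M_def)
    moreover have "?v \<noteq> 0\<^sub>v (n + 1)"
      using w(1) by (auto simp: nontrivial_def vec_eq_iff less_Suc_eq_le)
    ultimately show "\<exists>v. v \<in> carrier_vec (n + 1) \<and> v \<noteq> 0\<^sub>v (n + 1) \<and> M *\<^sub>v v = 0\<^sub>v (n + 1)"
      using v by blast
  qed
  finally show ?thesis .
qed

lemma lin_cong: "(\<And>j. j \<le> n \<Longrightarrow> x j = y j) \<Longrightarrow> lin n A x i = lin n A y i"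
  unfolding lin_def by (intro sum.cong) auto

lemma form_eval_cong: "(\<And>j. j \<le> n \<Longrightarrow> x j = y j) \<Longrightarrow> form_eval n d c i x = form_eval n d c i y"
  unfolding form_eval_def mono_eval_def by (intro sum.cong refl arg_cong[of _ _ "\<lambda>u. _ * u"] prod.cong) auto

definition inverse_on :: "nat \<Rightarrow> (nat \<Rightarrow> nat \<Rightarrow> 'k::comm_ring_1) \<Rightarrow> (nat \<Rightarrow> nat \<Rightarrow> 'k) \<Rightarrow> bool" where
  "inverse_on n A B \<longleftrightarrow> (\<forall>i\<le>n. \<forall>j\<le>n. (\<Sum>l\<le>n. A i l * B l j) = (if i = j then 1 else 0))"

lemma lin_inverse:
  assumes "inverse_on n A B" "i \<le> n"
  shows "lin n A (lin n B x) i = x i"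
proof -
  have "lin n A (lin n B x) i = (\<Sum>j\<le>n. (\<Sum>l\<le>n. A i l * B l j) * x j)"
    unfolding lin_def sum_distrib_left sum_distrib_right by (subst sum.swap) (simp add: mult.assoc)
  also have "\<dots> = (\<Sum>j\<le>n. if i = j then x j else 0)"
    using assms by (intro sum.cong) (auto simp: inverse_on_def)
  finally show ?thesis using assms(2) by simp
qed

lemma inverse_on_fps_const:
  assumes "inverse_on n A B"
  shows "inverse_on n (\<lambda>i j. fps_const (A i j)) (\<lambda>i j. fps_const (B i j))"
  using assms unfolding inverse_on_def by (auto simp flip: fps_const_sum)

lemma exists_inverse_on:
  fixes A :: "nat \<Rightarrow> nat \<Rightarrow> 'k::field"
  assumes inj: "\<And>y. \<forall>i\<le>n. lin n A y i = 0 \<Longrightarrow> \<not> nontrivial n y"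
  obtains B where "inverse_on n A B" "inverse_on n B A"
proof -
  define M where "M = mat (n + 1) (n + 1) (\<lambda>(i, j). A i j)"
  have M: "M \<in> carrier_mat (n + 1) (n + 1)" by (simp add: M_def)
  have "det M \<noteq> 0"
  proof
    assume "det M = 0"
    then obtain v where v: "v \<in> carrier_vec (n + 1)" "v \<noteq> 0\<^sub>v (n + 1)" "M *\<^sub>v v = 0\<^sub>v (n + 1)"
      using det_0_iff_vec_prod_zero[OF M] by blast
    have "lin n A (vec_index v) i = vec_index (M *\<^sub>v v) i" if "i \<le> n" for i
      using that v(1) unfolding lin_def
      by (auto simp: M_def scalar_prod_def lessThan_atLeast0[symmetric] lessThan_Suc_atMost intro!: sum.cong)
    then have "\<not> nontrivial n (vec_index v)" using v(3) by (intro inj) auto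
    then show False using v(1,2) by (auto simp: nontrivial_def vec_eq_iff less_Suc_eq_le)
  qed
  from det_non_zero_imp_unit[OF M this, of "()"]
  obtain N where N: "N \<in> carrier_mat (n + 1) (n + 1)" "N * M = 1\<^sub>m (n + 1)" "M * N = 1\<^sub>m (n + 1)"
    by (auto simp: Units_def ring_mat_def)
  have prod: "(\<Sum>l\<le>n. U i l * V l j) = (if i = j then 1 else 0)"
    if "mat (n + 1) (n + 1) (\<lambda>(i, j). U i j) * mat (n + 1) (n + 1) (\<lambda>(i, j). V i j) = 1\<^sub>m (n + 1)"
      "i \<le> n" "j \<le> n" for U V :: "nat \<Rightarrow> nat \<Rightarrow> 'k" and i j
  proof -
    have "(\<Sum>l\<le>n. U i l * V l j) =
      (mat (n + 1) (n + 1) (\<lambda>(i, j). U i j) * mat (n + 1) (n + 1) (\<lambda>(i, j). V i j)) $$ (i, j)"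
      using that(2,3)
      by (auto simp: scalar_prod_def lessThan_atLeast0[symmetric] lessThan_Suc_atMost intro!: sum.cong)
    then show ?thesis unfolding that(1) using that(2,3) by simp
  qed
  define B where "B i j = N $$ (i, j)" for i j
  have NB: "N = mat (n + 1) (n + 1) (\<lambda>(i, j). B i j)"
    using N(1) by (intro eq_matI) (auto simp: B_def)
  show thesis
    using N(2,3) prod[of A B] prod[of B A] unfolding NB M_def
    by (intro that[of B]) (auto simp: inverse_on_def)
qed

text \<open>By Euler's identity the kernel of the derivative at a critical point P does not contain P,
  because f(P) is not the zero vector.\<close>

lemma adapted_coordinates:
  fixes c :: "nat \<times> nat list \<Rightarrow> 'k::field_char_0"
  assumes c: "End_rep n d c" "d \<ge> 1" and P: "nontrivial n P" and w: "nontrivial n w"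
    and ker: "\<And>i. i \<le> n \<Longrightarrow> (\<Sum>j\<le>n. form_deriv_eval n d c i j P * w j) = 0"
  obtains a b A B where "a \<le> n" "b \<le> n" "a \<noteq> b" "inverse_on n A B" "inverse_on n B A"
    "\<And>i. A i a = P i" "\<And>i. A i b = w i"
proof -
  \<comment> \<open>If all 2x2 minors of (P, w) vanished, w would be a multiple of P, and the kernel
    condition would contradict Euler's identity.\<close>
  have "\<exists>a\<le>n. \<exists>b\<le>n. P a * w b \<noteq> P b * w a"
  proof (rule ccontr)
    assume "\<not> ?thesis"
    then have eq: "\<And>a b. a \<le> n \<Longrightarrow> b \<le> n \<Longrightarrow> P a * w b = P b * w a" by blast
    obtain l where l: "l \<le> n" "P l \<noteq> 0" using P by (auto simp: nontrivial_def)
    obtain i where i: "i \<le> n" "form_eval n d c i P \<noteq> 0" using c P by (auto simp: End_rep_def)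
    have "0 = P l * (\<Sum>j\<le>n. form_deriv_eval n d c i j P * w j)" using ker[OF i(1)] by simp
    also have "\<dots> = (\<Sum>j\<le>n. form_deriv_eval n d c i j P * (P l * w j))"
      by (simp add: sum_distrib_left mult_ac)
    also have "\<dots> = (\<Sum>j\<le>n. form_deriv_eval n d c i j P * (P j * w l))"
      using eq[OF l(1)] by (intro sum.cong) auto
    also have "\<dots> = of_nat d * form_eval n d c i P * w l"
      unfolding euler_identity[symmetric] by (simp add: sum_distrib_right mult.assoc)
    finally have "w l = 0" using i(2) c(2) by simp
    then have "w j = 0" if "j \<le> n" for j using eq[OF l(1) that] l(2) by simp
    then show False using w by (auto simp: nontrivial_def)
  qed
  then obtain a b where ab: "a \<le> n" "b \<le> n" "P a * w b \<noteq> P b * w a" by blast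
  then have "a \<noteq> b" by auto
  \<comment> \<open>The identity matrix with columns a and b replaced by P and w; its determinant is
    the minor just found to be nonzero.\<close>
  define A where "A i j = (if j = a then P i else if j = b then w i else if i = j then 1 else 0)" for i j
  have Alin: "lin n A y i = y a * P i + y b * w i + (if i = a \<or> i = b then 0 else y i)" if "i \<le> n" for y i
  proof -
    have "lin n A y i = (\<Sum>j\<le>n. (if j = a then y a * P i else 0) + (if j = b then y b * w i else 0) +
        (if j = i then if i = a \<or> i = b then 0 else y i else 0))"
      unfolding lin_def A_def using \<open>a \<noteq> b\<close> by (intro sum.cong) auto
    then show ?thesis using ab that by (simp add: sum.distrib)
  qed
  obtain B where B: "inverse_on n A B" "inverse_on n B A"
  proof (rule exists_inverse_on[of n A])
    fix y assume y: "\<forall>i\<le>n. lin n A y i = 0"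
    have 1: "y a * P a + y b * w a = 0" "y a * P b + y b * w b = 0"
      using y ab Alin[of a y] Alin[of b y] by auto
    have "y a * (P a * w b - P b * w a) = (y a * P a + y b * w a) * w b - (y a * P b + y b * w b) * w a"
      "y b * (P a * w b - P b * w a) = (y a * P b + y b * w b) * P a - (y a * P a + y b * w a) * P b"
      by (simp_all add: algebra_simps)
    then have "y a = 0" "y b = 0" using 1 ab(3) by auto
    then have "y i = 0" if "i \<le> n" for i using y Alin[OF that, of y] that by (auto split: if_splits)
    then show "\<not> nontrivial n y" by (auto simp: nontrivial_def)
  qed
  show thesis
    using \<open>a \<noteq> b\<close> by (intro that[OF ab(1,2) _ B]) (auto simp: A_def)
qed

section \<open>The deformation\<close>

lemma map_rep_iterate_nontrivial:
  assumes "End_rep n d c" "nontrivial n x"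
  shows "nontrivial n ((map_rep n d c ^^ s) x)"
proof (induction s)
  case (Suc s)
  then show ?case using assms(1) unfolding End_rep_def by (auto simp: nontrivial_def map_rep_def)
qed (use assms in auto)

text \<open>In the coordinates y = B x, with base point a and critical direction b, the base map is the
  power map, and the family adds \<epsilon> (c0 - b0) and a translation by T in the affine chart y_a = 1.
  Postcomposition does not affect the kernel of the derivative, so P stays critical.\<close>

locale marked_family =
  fixes n d a b :: nat and A B :: "nat \<Rightarrow> nat \<Rightarrow> 'k::{alg_closed_field, field_char_0}"
    and P w :: "nat \<Rightarrow> 'k" and c0 b0 :: "nat \<times> nat list \<Rightarrow> 'k"
  assumes d: "d \<ge> 2"
    and a: "a \<le> n" and b: "b \<le> n" and ab: "a \<noteq> b"
    and AB: "inverse_on n A B" and BA: "inverse_on n B A"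
    and Aa: "\<And>i. A i a = P i" and Ab: "\<And>i. A i b = w i"
    and P: "nontrivial n P" and w: "nontrivial n w"
    and ker: "\<And>i. i \<le> n \<Longrightarrow> (\<Sum>j\<le>n. form_deriv_eval n d c0 i j P * w j) = 0"
    and b0: "\<And>i x. i \<le> n \<Longrightarrow>
      form_eval n d (\<lambda>v. fps_const (b0 v)) i x = clin n A (\<lambda>l. clin n B x l ^ d) i"
begin

definition J :: "nat set" where "J = {..n} - {a}"

lemma J: "finite J" "j \<in> J \<Longrightarrow> j \<le> n" "a \<notin> J" "j \<in> J \<Longrightarrow> j \<noteq> a"
  by (auto simp: J_def)

text \<open>The ring and the embedding \<kappa> of k are parameters: the family is used over
  k[[\<epsilon>]], over k after specialization, and over k[\<epsilon>], where \<epsilon> = 1 makes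
  sense.\<close>

definition seg :: "('k \<Rightarrow> 'r::comm_ring_1) \<Rightarrow> 'r \<Rightarrow> nat \<times> nat list \<Rightarrow> 'r" where
  "seg \<kappa> \<epsilon> v = (1 - \<epsilon>) * \<kappa> (b0 v) + \<epsilon> * \<kappa> (c0 v)"

text \<open>Postcomposition with the unipotent map y_j -> y_j + T_j y_a for j in J, written in the
  original coordinates; the sum over l is the coordinate y_a of the image.\<close>

definition fam :: "('k \<Rightarrow> 'r::comm_ring_1) \<Rightarrow> 'r \<Rightarrow> (nat \<Rightarrow> 'r) \<Rightarrow> nat \<times> nat list \<Rightarrow> 'r" where
  "fam \<kappa> \<epsilon> T v = (if v \<in> coeff_idx n d then seg \<kappa> \<epsilon> v +
     (\<Sum>j\<in>J. T j * \<kappa> (A (fst v) j)) * (\<Sum>l\<le>n. \<kappa> (B a l) * seg \<kappa> \<epsilon> (l, snd v)) else 0)"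

text \<open>The given map minus the power map, both in the coordinates y; hence \<open>base\<close>
  is the segment in these coordinates.\<close>

definition pert :: "nat \<Rightarrow> (nat \<Rightarrow> 'k fps) \<Rightarrow> 'k fps" where
  "pert j y = clin n B (\<lambda>l. form_eval n d (\<lambda>v. fps_const (c0 v)) l (clin n A y)) j - y j ^ d"

definition base :: "'k fps \<Rightarrow> nat \<Rightarrow> (nat \<Rightarrow> 'k fps) \<Rightarrow> 'k fps" where
  "base \<epsilon> j y = y j ^ d + \<epsilon> * pert j y"

definition step :: "'k fps \<Rightarrow> (nat \<Rightarrow> 'k fps) \<Rightarrow> (nat \<Rightarrow> 'k fps) \<Rightarrow> nat \<Rightarrow> 'k fps" where
  "step \<epsilon> T y j = base \<epsilon> j y + (if j \<in> J then T j * base \<epsilon> a y else 0)"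

lemmas AB' = inverse_on_fps_const[OF AB] and BA' = inverse_on_fps_const[OF BA]

lemma form_eval_seg:
  "form_eval n d (seg \<kappa> \<epsilon>) i x = (1 - \<epsilon>) * form_eval n d (\<lambda>v. \<kappa> (b0 v)) i x +
     \<epsilon> * form_eval n d (\<lambda>v. \<kappa> (c0 v)) i x"
  unfolding form_eval_def seg_def sum_distrib_left sum.distrib[symmetric]
  by (intro sum.cong refl) (simp add: algebra_simps)

lemma form_eval_fam:
  assumes "i \<le> n"
  shows "form_eval n d (fam \<kappa> \<epsilon> T) i x = form_eval n d (seg \<kappa> \<epsilon>) i x +
    (\<Sum>j\<in>J. T j * \<kappa> (A i j)) * (\<Sum>l\<le>n. \<kappa> (B a l) * form_eval n d (seg \<kappa> \<epsilon>) l x)"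
proof -
  let ?t = "\<Sum>j\<in>J. T j * \<kappa> (A i j)"
  have "form_eval n d (fam \<kappa> \<epsilon> T) i x = (\<Sum>\<alpha>\<in>deg_monos n d.
      seg \<kappa> \<epsilon> (i, \<alpha>) * mono_eval n \<alpha> x + ?t * (\<Sum>l\<le>n. \<kappa> (B a l) * (seg \<kappa> \<epsilon> (l, \<alpha>) * mono_eval n \<alpha> x)))"
    unfolding form_eval_def
    by (intro sum.cong refl)
       (use assms in \<open>simp add: fam_def coeff_idx_def distrib_right sum_distrib_right mult.assoc\<close>)
  also have "\<dots> = form_eval n d (seg \<kappa> \<epsilon>) i x +
      ?t * (\<Sum>\<alpha>\<in>deg_monos n d. \<Sum>l\<le>n. \<kappa> (B a l) * (seg \<kappa> \<epsilon> (l, \<alpha>) * mono_eval n \<alpha> x))"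
    by (simp add: sum.distrib form_eval_def flip: sum_distrib_left)
  also have "(\<Sum>\<alpha>\<in>deg_monos n d. \<Sum>l\<le>n. \<kappa> (B a l) * (seg \<kappa> \<epsilon> (l, \<alpha>) * mono_eval n \<alpha> x)) =
      (\<Sum>l\<le>n. \<kappa> (B a l) * form_eval n d (seg \<kappa> \<epsilon>) l x)"
    by (subst sum.swap) (simp add: form_eval_def sum_distrib_left)
  finally show ?thesis .
qed

lemma B_seg:
  assumes "j \<le> n"
  shows "clin n B (\<lambda>l. form_eval n d (seg fps_const \<epsilon>) l (clin n A y)) j = base \<epsilon> j y"
proof -
  let ?f = "\<lambda>c l. form_eval n d (\<lambda>v. fps_const (c v)) l (clin n A y)"
  have "clin n B (?f b0) j = clin n B (clin n A (\<lambda>l. clin n B (clin n A y) l ^ d)) j"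
    by (intro lin_cong b0)
  also have "\<dots> = y j ^ d" using assms by (simp add: lin_inverse[OF BA'])
  finally have *: "clin n B (?f b0) j = y j ^ d" .
  have "clin n B (\<lambda>l. form_eval n d (seg fps_const \<epsilon>) l (clin n A y)) j =
    (1 - \<epsilon>) * clin n B (?f b0) j + \<epsilon> * clin n B (?f c0) j"
    unfolding form_eval_seg lin_def sum_distrib_left sum.distrib[symmetric]
    by (intro sum.cong refl) (simp add: algebra_simps)
  then show ?thesis unfolding * by (simp add: base_def pert_def algebra_simps)
qed

lemma B_fam:
  assumes "j \<le> n"
  shows "clin n B (\<lambda>l. form_eval n d (fam fps_const \<epsilon> T) l (clin n A y)) j = step \<epsilon> T y j"
proof -
  let ?s = "\<lambda>l. form_eval n d (seg fps_const \<epsilon>) l (clin n A y)"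
  have "clin n B (\<lambda>l. form_eval n d (fam fps_const \<epsilon> T) l (clin n A y)) j =
    (\<Sum>i\<le>n. fps_const (B j i) * (?s i + (\<Sum>m\<in>J. T m * fps_const (A i m)) * clin n B ?s a))"
    unfolding lin_def[of n _ _ j] by (intro sum.cong refl) (simp add: form_eval_fam lin_def)
  also have "\<dots> = clin n B ?s j +
      (\<Sum>i\<le>n. fps_const (B j i) * (\<Sum>m\<in>J. T m * fps_const (A i m))) * clin n B ?s a"
    by (simp add: distrib_left sum.distrib lin_def[of n _ _ j] sum_distrib_right mult.assoc)
  also have "(\<Sum>i\<le>n. fps_const (B j i) * (\<Sum>m\<in>J. T m * fps_const (A i m))) =
      (\<Sum>m\<in>J. T m * (\<Sum>i\<le>n. fps_const (B j i) * fps_const (A i m)))"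
    unfolding sum_distrib_left by (subst sum.swap) (simp only: mult_ac)
  also have "\<dots> = (\<Sum>m\<in>J. if m = j then T m else 0)"
    using BA' assms J(2) by (intro sum.cong) (auto simp: inverse_on_def)
  finally show ?thesis using assms a J(1) by (simp add: B_seg step_def)
qed

lemma fam_eval:
  assumes "i \<le> n"
  shows "form_eval n d (fam fps_const \<epsilon> T) i (clin n A y) = clin n A (step \<epsilon> T y) i"
proof -
  have "form_eval n d (fam fps_const \<epsilon> T) i (clin n A y) =
    clin n A (clin n B (\<lambda>l. form_eval n d (fam fps_const \<epsilon> T) l (clin n A y))) i"
    using lin_inverse[OF AB' assms] by simp
  also have "\<dots> = clin n A (step \<epsilon> T y) i" by (intro lin_cong B_fam)
  finally show ?thesis .
qed

text \<open>The orbit of P in homogeneous coordinates, not rescaled: coordinate a is 1 only modulo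
  \<epsilon>, and returning to P means that the coordinates in J vanish.\<close>

primrec orb :: "(nat \<Rightarrow> 'k fps) \<Rightarrow> nat \<Rightarrow> nat \<Rightarrow> 'k fps" where
  "orb T 0 = (\<lambda>j. if j = a then 1 else 0)"
| "orb T (Suc s) = step fps_X T (orb T s)"

lemma orb_map_rep:
  "i \<le> n \<Longrightarrow> (map_rep n d (fam fps_const fps_X T) ^^ s) (\<lambda>l. fps_const (P l)) i = clin n A (orb T s) i"
proof (induction s arbitrary: i)
  case 0
  have "clin n A (orb T 0) i = (\<Sum>j\<le>n. if j = a then fps_const (P i) else 0)"
    unfolding lin_def by (intro sum.cong) (auto simp: Aa)
  then show ?case using a by simp
next
  case (Suc s)
  let ?f = "fam fps_const fps_X T" and ?P = "\<lambda>l. fps_const (P l)"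
  have "(map_rep n d ?f ^^ Suc s) ?P i = form_eval n d ?f i ((map_rep n d ?f ^^ s) ?P)"
    unfolding funpow.simps o_apply by (subst map_rep_def) (simp add: Suc.prems)
  also have "\<dots> = form_eval n d ?f i (clin n A (orb T s))"
    by (rule form_eval_cong) (rule Suc.IH)
  finally show ?case using fam_eval[OF Suc.prems] by simp
qed

lemma poly_fun_pert: "poly_fun (pert j)"
  unfolding pert_def lin_def
  by (intro poly_fun_diff poly_fun_sum poly_fun_mult poly_fun_const poly_fun_power poly_fun_var poly_fun_form_eval)

lemma base_nth_0: "base fps_X j y $ 0 = (y j $ 0) ^ d"
  by (simp add: base_def fps_nth_power_0)

text \<open>At \<epsilon> = 0 the perturbation drops out, coordinate a stays 1, and the others obey
  separate recursions z -> z^d + t_j.\<close>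

lemma orb_nth_0:
  assumes "\<And>j. T j $ 0 = t j"
  shows "orb T s a $ 0 = 1" "j \<in> J \<Longrightarrow> orb T s j $ 0 = poly (center_poly d s) (t j)"
proof (induction s arbitrary: j)
  case 0
  { case 1 then show ?case by simp next case 2 then show ?case using J by (auto simp: center_poly_0) }
next
  case (Suc s)
  { case 1 then show ?case using Suc J by (simp add: step_def base_nth_0)
  next case 2 then show ?case using Suc assms J by (simp add: step_def base_nth_0 center_poly_Suc) }
qed

text \<open>The factor \<epsilon> before \<open>pert\<close> shifts orders by one, so at order m
  only the pure power contributes to the change; this makes the Jacobian diagonal.\<close>

lemma base_diff_nth:
  assumes "m \<ge> 1" "\<And>j i. i < m \<Longrightarrow> x j $ i = y j $ i"
  shows "\<And>i. i < m \<Longrightarrow> base fps_X j x $ i = base fps_X j y $ i"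
    "(base fps_X j x - base fps_X j y) $ m = of_nat d * (x j $ 0) ^ (d - 1) * (x j - y j) $ m"
proof -
  have "poly_fun (base fps_X j)"
    unfolding base_def by (intro poly_fun_add poly_fun_mult poly_fun_const poly_fun_power poly_fun_var poly_fun_pert)
  then show "\<And>i. i < m \<Longrightarrow> base fps_X j x $ i = base fps_X j y $ i"
    by (rule poly_fun_cong_mod) (use assms in auto)
  have "pert j x $ (m - 1) = pert j y $ (m - 1)"
    by (rule poly_fun_cong_mod[OF poly_fun_pert, of m]) (use assms in auto)
  then have "(fps_X * (pert j x - pert j y)) $ m = 0" using assms(1) by simp
  moreover have "base fps_X j x - base fps_X j y = (x j ^ d - y j ^ d) + fps_X * (pert j x - pert j y)"
    by (simp add: base_def algebra_simps)
  ultimately have "(base fps_X j x - base fps_X j y) $ m = (x j ^ d - y j ^ d) $ m"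
    by (simp only: fps_add_nth) simp
  then show "(base fps_X j x - base fps_X j y) $ m = of_nat d * (x j $ 0) ^ (d - 1) * (x j - y j) $ m"
    using fps_power_diff_nth[of m "x j" "y j" d] assms by simp
qed

text \<open>The induction on s reproduces the recursion of \<open>pderiv_center_poly\<close>; its
  summand 1 comes from the explicit T_j in the last step. Coordinate a does not change at order m,
  so no mixed terms appear.\<close>

lemma orb_diff_nth:
  assumes m: "m \<ge> 1" and T: "\<And>j. T j $ 0 = t j" and eq: "\<And>j i. i < m \<Longrightarrow> T j $ i = T' j $ i"
  shows "(\<forall>i<m. orb T s j $ i = orb T' s j $ i) \<and>
    (orb T s j - orb T' s j) $ m =
      (if j \<in> J then poly (pderiv (center_poly d s)) (t j) * (T j - T' j) $ m else 0)"
proof (induction s arbitrary: j)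
  case 0
  then show ?case by (simp add: center_poly_0)
next
  case (Suc s)
  let ?x = "orb T s" and ?y = "orb T' s"
  have low: "i < m \<Longrightarrow> ?x j $ i = ?y j $ i" for i j using Suc by blast
  have bd: "i < m \<Longrightarrow> base fps_X j ?x $ i = base fps_X j ?y $ i"
    "(base fps_X j ?x - base fps_X j ?y) $ m = of_nat d * (?x j $ 0) ^ (d - 1) * (?x j - ?y j) $ m"
    for i j
    using base_diff_nth[of m ?x ?y, OF m low] by blast+
  have b0: "base fps_X a ?x $ 0 = 1" using orb_nth_0(1)[of T t, OF T] by (simp add: base_nth_0)
  have b0': "base fps_X a ?y $ 0 = 1" using bd(1)[of 0 a] b0 m by simp
  have ba: "(base fps_X a ?x - base fps_X a ?y) $ m = 0"
    using bd(2)[of a] Suc[of a] J by simp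
  show ?case
  proof (cases "j \<in> J")
    case False
    then show ?thesis using bd(1)[of _ j] bd(2)[of j] Suc[of j] by (simp add: step_def)
  next
    case True
    have low': "(T j * base fps_X a ?x) $ i = (T' j * base fps_X a ?y) $ i" if "i < m" for i
      using that bd(1) eq by (auto simp: fps_mult_nth intro!: sum.cong)
    have 1: "(T j * base fps_X a ?x - T' j * base fps_X a ?y) $ m = (T j - T' j) $ m"
      using fps_mult_diff_nth[of m "T j" "T' j" "base fps_X a ?x" "base fps_X a ?y"] eq bd(1) m b0 ba
      by simp
    have 2: "(base fps_X j ?x - base fps_X j ?y) $ m =
      of_nat d * poly (center_poly d s) (t j) ^ (d - 1) * poly (pderiv (center_poly d s)) (t j) * (T j - T' j) $ m"
      using bd(2)[of j] Suc[of j] True orb_nth_0(2)[of T t, OF T True] by (simp add: mult.assoc)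
    have split: "orb T (Suc s) j - orb T' (Suc s) j =
      (base fps_X j ?x - base fps_X j ?y) + (T j * base fps_X a ?x - T' j * base fps_X a ?y)"
      using True by (simp add: step_def)
    have "(orb T (Suc s) j - orb T' (Suc s) j) $ m = poly (pderiv (center_poly d (Suc s))) (t j) * (T j - T' j) $ m"
      unfolding split fps_add_nth 1 2 using d by (simp add: pderiv_center_poly algebra_simps)
    moreover have "orb T (Suc s) j $ i = orb T' (Suc s) j $ i" if "i < m" for i
      using True low'[OF that] bd(1)[OF that] by (simp add: step_def)
    ultimately show ?thesis using True by simp
  qed
qed

lemma exists_periodic_lift:
  assumes t: "\<And>j. j \<in> J \<Longrightarrow> poly (center_poly d (Suc s)) (t j) = 0"
  shows "\<exists>T. (\<forall>j. T j $ 0 = t j) \<and> (\<forall>j\<in>J. orb T (Suc s) j = 0)"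
proof -
  let ?D = "\<lambda>j. poly (pderiv (center_poly d (Suc s))) (t j)"
  obtain T where "\<And>j. T j $ 0 = t j" "\<And>j. j \<in> J \<Longrightarrow> orb T (Suc s) j = 0"
  proof (rule fps_hensel[of J ?D "\<lambda>T. orb T (Suc s)" t])
    fix j assume j: "j \<in> J"
    show "?D j \<noteq> 0" using center_poly_roots_simple[OF d t[OF j]] .
    show "orb (\<lambda>j. fps_const (t j)) (Suc s) j $ 0 = 0"
      using t[OF j] j by (subst orb_nth_0(2)[where t = t]) auto
    fix T T' :: "nat \<Rightarrow> 'k fps" assume TT: "\<And>j. T j $ 0 = t j" "\<And>j. T' j $ 0 = t j"
    show "orb T (Suc s) j $ 0 = orb T' (Suc s) j $ 0"
      using orb_nth_0(2)[of T t, OF TT(1) j] orb_nth_0(2)[of T' t, OF TT(2) j] by metis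
  next
    fix m T T' j assume "1 \<le> m" "\<And>j. T j $ 0 = t j" "\<And>j i. i < m \<Longrightarrow> T j $ i = T' j $ i" "j \<in> J"
    then show "(orb T (Suc s) j - orb T' (Suc s) j) $ m = ?D j * (T j - T' j) $ m"
      using orb_diff_nth[of m T t T' "Suc s" j] by simp
  qed (rule that)
  then show ?thesis by blast
qed

text \<open>T does not occur: the translation is invertible, so common zeros of the family are those
  of the segment.\<close>

definition degenerate :: "'k set" where
  "degenerate = {e. \<exists>y. nontrivial n y \<and> (\<forall>j\<le>n. base (fps_const e) j (\<lambda>l. fps_const (y l)) = 0)}"

lemma finite_degenerate: "finite degenerate"
  unfolding degenerate_def base_def
proof (rule finite_degenerate_parameters)
  fix j assume "j \<le> n"
  then have "isform n (d * 1) (\<lambda>y. y j ^ d)" by (intro isform_power isform_var)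
  then show "isform n d (pert j)"
    unfolding pert_def lin_def[of n "\<lambda>i j. fps_const (B i j)"]
    by (intro isform_diff isform_sum isform_cmult isform_form_eval_lin) simp
qed

lemma fam_fps_const: "fps_const (fam id e \<tau> v) = fam fps_const (fps_const e) (\<lambda>j. fps_const (\<tau> j)) v"
  by (simp add: fam_def seg_def fps_const_sum flip: fps_const_add fps_const_mult fps_const_sub)

lemma End_rep_fam:
  assumes e: "e \<notin> degenerate"
  shows "End_rep n d (fam id e \<tau>)"
  unfolding End_rep_def
proof (intro conjI allI impI)
  fix v assume "v \<notin> coeff_idx n d"
  then show "fam id e \<tau> v = 0" by (simp add: fam_def)
next
  fix x :: "nat \<Rightarrow> 'k" assume x: "nontrivial n x"
  show "\<exists>i\<le>n. form_eval n d (fam id e \<tau>) i x \<noteq> 0"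
  proof (rule ccontr)
    assume "\<not> ?thesis"
    then have z: "form_eval n d (fam id e \<tau>) i x = 0" if "i \<le> n" for i using that by blast
    define y where "y = lin n B x"
    let ?y = "\<lambda>l. fps_const (y l)" and ?T = "\<lambda>j. fps_const (\<tau> j)"
    have yx: "clin n A ?y i = fps_const (x i)" if "i \<le> n" for i
    proof -
      have "clin n A ?y i = fps_const (lin n A y i)"
        by (simp add: lin_def[of n A] lin_def[of n "\<lambda>i j. fps_const (A i j)"] fps_const_sum flip: fps_const_mult)
      then show ?thesis using lin_inverse[OF AB that] by (simp add: y_def)
    qed
    have "form_eval n d (fam fps_const (fps_const e) ?T) i (clin n A ?y) = 0" if "i \<le> n" for i
    proof -
      have "form_eval n d (fam fps_const (fps_const e) ?T) i (clin n A ?y) =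
        form_eval n d (\<lambda>v. fps_const (fam id e \<tau> v)) i (\<lambda>l. fps_const (x l))"
        unfolding fam_fps_const by (rule form_eval_cong) (rule yx)
      then show ?thesis using z[OF that] by (simp flip: fps_const_form_eval)
    qed
    then have "clin n B (\<lambda>l. form_eval n d (fam fps_const (fps_const e) ?T) l (clin n A ?y)) j = 0" for j
      by (simp add: lin_def[of n "\<lambda>i j. fps_const (B i j)"])
    then have st: "step (fps_const e) ?T ?y j = 0" if "j \<le> n" for j using B_fam[OF that] by metis
    have ba: "base (fps_const e) a ?y = 0" using st[OF a] J(3) by (simp add: step_def)
    have "base (fps_const e) j ?y = 0" if "j \<le> n" for j using st[OF that] ba by (simp add: step_def split: if_splits)
    moreover have "nontrivial n y"
    proof (rule ccontr)
      assume "\<not> nontrivial n y"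
      then have "lin n A y i = 0" for i by (simp add: lin_def nontrivial_def)
      then have "x i = 0" if "i \<le> n" for i using lin_inverse[OF AB that, of x] by (simp add: y_def)
      then show False using x by (auto simp: nontrivial_def)
    qed
    ultimately show False using e by (auto simp: degenerate_def)
  qed
qed

text \<open>Along e_a + \<epsilon> e_b the power map has no linear term because d \<ge> 2, and c0
  has none by the choice of w. Both the segment and linear postcomposition preserve this.\<close>

lemma fam_critical: "jac_eval n d (fam id e \<tau>) P = 0"
  unfolding jac_eval_eq_0_iff
proof (intro exI[of _ w] conjI w allI impI)
  fix i assume i: "i \<le> n"
  let ?T = "\<lambda>j. fps_const (\<tau> j)"
  define y where "y j = (if j = a then 1 else if j = b then fps_X else 0 :: 'k fps)" for j
  have Ay: "clin n A y l = fps_const (P l) + fps_X * fps_const (w l)" for l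
  proof -
    have "clin n A y l = (\<Sum>j\<le>n. (if j = a then fps_const (P l) else 0) +
        (if j = b then fps_X * fps_const (w l) else 0))"
      unfolding lin_def y_def using ab by (intro sum.cong) (auto simp: Aa Ab)
    then show ?thesis using a b by (simp add: sum.distrib)
  qed
  have y1: "(y j ^ d) $ 1 = 0" for j
    using d by (auto simp: y_def fps_X_power_nth power_0_left)
  have c1: "form_eval n d (\<lambda>v. fps_const (c0 v)) l (clin n A y) $ 1 = 0" if "l \<le> n" for l
    unfolding Ay form_eval_directional_derivative using ker[OF that] .
  have "clin n B (\<lambda>l. form_eval n d (\<lambda>v. fps_const (c0 v)) l (clin n A y)) j $ 1 = 0" for j
    unfolding lin_def[of n "\<lambda>i j. fps_const (B i j)"] fps_sum_nth fps_mult_left_const_nth using c1 by simp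
  then have "pert j y $ 1 = 0" for j unfolding pert_def using y1 by simp
  then have "base (fps_const e) j y $ 1 = 0" for j
    unfolding base_def using y1 by simp
  then have "step (fps_const e) ?T y j $ 1 = 0" for j unfolding step_def by simp
  then have "clin n A (step (fps_const e) ?T y) i $ 1 = 0"
    unfolding lin_def fps_sum_nth fps_mult_left_const_nth by simp
  then have "form_eval n d (\<lambda>v. fps_const (fam id e \<tau> v)) i (\<lambda>l. fps_const (P l) + fps_X * fps_const (w l)) $ 1 = 0"
    unfolding fam_fps_const Ay[symmetric] using fam_eval[OF i] by simp
  then show "(\<Sum>j\<le>n. form_deriv_eval n d (fam id e \<tau>) i j P * w j) = 0"
    unfolding form_eval_directional_derivative .
qed

lemma fam_hom:
  assumes hom: "hom_on R \<phi>" and const: "\<And>e. fps_const e \<in> R" "\<And>e. \<phi> (fps_const e) = e"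
    and mem: "fps_X \<in> R" "\<And>j. j \<in> J \<Longrightarrow> T j \<in> R"
  shows "fam fps_const fps_X T v \<in> R"
    "\<phi> (fam fps_const fps_X T v) = fam id (\<phi> fps_X) (\<lambda>j. \<phi> (T j)) v"
proof -
  note S = hom_on_subring[OF hom]
  note cl = subring_closed[OF S] subring_sum[OF S]
  note ho = hom_on_add[OF hom] hom_on_mult[OF hom] hom_on_diff[OF hom] hom_on_sum[OF hom] hom_on_one[OF hom] hom_on_zero[OF hom]
  have seg: "seg fps_const fps_X v \<in> R" "\<phi> (seg fps_const fps_X v) = seg id (\<phi> fps_X) v" for v
    unfolding seg_def using const mem by (simp_all add: cl ho)
  show "fam fps_const fps_X T v \<in> R"
    unfolding fam_def using seg const mem by (cases v) (auto intro!: cl)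
  show "\<phi> (fam fps_const fps_X T v) = fam id (\<phi> fps_X) (\<lambda>j. \<phi> (T j)) v"
    unfolding fam_def using seg const mem by (simp add: cl ho)
qed

lemma periodic_critical_specialization:
  assumes orb: "\<And>j. j \<in> J \<Longrightarrow> orb T (Suc s) j = 0"
    and nz: "hpoly_eval n d G (\<lambda>\<beta>. fps_const (g \<beta>)) (fam fps_const fps_X T) \<noteq> 0"
  shows "\<exists>c. End_rep n d c \<and> hpoly_eval n d G g c \<noteq> 0 \<and> has_periodic_crit_pt n d c"
proof -
  let ?F = "hpoly_eval n d G (\<lambda>\<beta>. fps_const (g \<beta>)) (fam fps_const fps_X T)"
  \<comment> \<open>A homomorphism that does not kill \<open>?D\<close> sends the series variable
    outside the finite degenerate set.\<close>
  let ?D = "\<Prod>e\<in>degenerate. fps_X - fps_const e :: 'k fps"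
  obtain R where R: "specializable fps_const R" "insert fps_X (T ` J) \<subseteq> R"
    by (rule specializable_extension[OF hom_on_fps_const, of "insert fps_X (T ` J)"])
       (use J(1) in \<open>auto simp: inj_def\<close>)
  then have S: "is_subring R" and const: "\<And>e. fps_const e \<in> R" and mem: "fps_X \<in> R" "\<And>j. j \<in> J \<Longrightarrow> T j \<in> R"
    by (auto simp: specializable_def)
  have FR: "?F \<in> R"
  proof -
    have "fam fps_const fps_X T v \<in> R" for v
      unfolding fam_def seg_def using const mem
      by (auto intro!: subring_closed[OF S] subring_sum[OF S])
    moreover have "hom_on R id" using S by (auto simp: hom_on_def)
    ultimately show ?thesis using const by (intro hom_on_hpoly_eval)
  qed
  have DR: "?D \<in> R" using const mem S by (auto intro!: subring_prod subring_diff)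
  have "fps_X \<noteq> (fps_const e :: 'k fps)" for e
  proof
    assume "fps_X = (fps_const e :: 'k fps)"
    from arg_cong[OF this, of "\<lambda>f. f $ 1"] show False by simp
  qed
  then have "?D \<noteq> 0" using finite_degenerate by simp
  then have "?F * ?D \<noteq> 0" "?F * ?D \<in> R" using nz FR DR subring_mult[OF S] by auto
  then obtain \<phi> where \<phi>: "hom_on R \<phi>" "\<And>e. \<phi> (fps_const e) = e" "\<phi> (?F * ?D) \<noteq> 0"
    using R(1) unfolding specializable_def by blast
  define c where "c = fam id (\<phi> fps_X) (\<lambda>j. \<phi> (T j))"
  note fh = fam_hom[where T = T, OF \<phi>(1) const \<phi>(2) mem]
  have "\<phi> ?F \<noteq> 0" "\<phi> ?D \<noteq> 0" using \<phi>(3) FR DR by (auto simp: hom_on_mult[OF \<phi>(1)])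
  have F: "hpoly_eval n d G g c \<noteq> 0"
    using \<open>\<phi> ?F \<noteq> 0\<close> hom_on_hpoly_eval(2)[OF \<phi>(1), of "\<lambda>\<beta>. fps_const (g \<beta>)" "fam fps_const fps_X T" n d G]
      const fh \<phi>(2) by (simp add: c_def)
  have "\<phi> fps_X \<notin> degenerate"
  proof
    assume "\<phi> fps_X \<in> degenerate"
    moreover have "\<phi> ?D = (\<Prod>e\<in>degenerate. \<phi> fps_X - e)"
      using const mem \<phi>(2) by (subst hom_on_prod[OF \<phi>(1)]) (auto intro!: subring_diff[OF S] simp: hom_on_diff[OF \<phi>(1)])
    ultimately have "\<phi> ?D = 0" using finite_degenerate by (auto simp: prod_zero_iff)
    with \<open>\<phi> ?D \<noteq> 0\<close> show False by simp
  qed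
  then have E: "End_rep n d c" unfolding c_def by (rule End_rep_fam)
  have crit: "jac_eval n d c P = 0" unfolding c_def by (rule fam_critical)
  let ?X = "(map_rep n d (fam fps_const fps_X T) ^^ Suc s) (\<lambda>l. fps_const (P l))"
  let ?Z = "(map_rep n d c ^^ Suc s) P"
  have XZ: "\<phi> (?X l) = ?Z l" and XR: "?X l \<in> R" for l
    using hom_on_map_rep_iterate[OF \<phi>(1), where c = "fam fps_const fps_X T" and
        x = "\<lambda>l. fps_const (P l)" and n = n and d = d and s = "Suc s" and l = l]
      fh const \<phi>(2) by (simp_all add: c_def del: funpow.simps)
  \<comment> \<open>The coordinates in J vanish, so the iterate is a multiple of column a of A,
    which is P.\<close>
  have X: "?X i = fps_const (P i) * orb T (Suc s) a" if "i \<le> n" for i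
  proof -
    have "?X i = (\<Sum>j\<le>n. if j = a then fps_const (P i) * orb T (Suc s) a else 0)"
      unfolding orb_map_rep[OF that] lin_def using orb by (intro sum.cong) (auto simp: Aa J_def)
    then show ?thesis using a by simp
  qed
  obtain l where l: "l \<le> n" "P l \<noteq> 0" using P by (auto simp: nontrivial_def)
  have Z: "?Z i = ?Z l / P l * P i" if "i \<le> n" for i
  proof -
    \<comment> \<open>Membership in R is at hand for the coordinates of \<open>?X\<close>, so the
      common scalar is eliminated before \<phi> is applied.\<close>
    have "?X i * fps_const (P l) = fps_const (P i) * ?X l"
      unfolding X[OF that] X[OF l(1)] by (simp add: mult_ac)
    then have "\<phi> (?X i) * P l = P i * \<phi> (?X l)"
      using hom_on_mult[OF \<phi>(1) XR const, of i "P l"] hom_on_mult[OF \<phi>(1) const XR, of "P i" l] \<phi>(2) by metis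
    then show ?thesis unfolding XZ using l by (simp add: field_simps)
  qed
  \<comment> \<open>A morphism keeps the specialized iterate nonzero, which makes the
    proportionality factor nonzero.\<close>
  have "nontrivial n ?Z" using E P by (rule map_rep_iterate_nontrivial)
  then obtain i where "i \<le> n" "?Z i \<noteq> 0" by (auto simp only: nontrivial_def)
  then have "?Z l / P l \<noteq> 0" using Z[of i] by auto
  then have "proj_eq n P ?Z" using Z unfolding proj_eq_def by blast
  then have "has_periodic_crit_pt n d c"
    unfolding has_periodic_crit_pt_def using P crit by (intro exI[of _ P] exI[of _ "Suc s"]) auto
  then show ?thesis using E F by blast
qed

text \<open>At \<epsilon> = 1 and T = 0 the family is c0, but a power series has no value at 1. So G
  is evaluated over k[\<epsilon>], which embeds into k[[\<epsilon>]].\<close>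

lemma hpoly_eval_fam_nonzero:
  assumes c0: "\<And>v. v \<notin> coeff_idx n d \<Longrightarrow> c0 v = 0" and G: "hpoly_eval n d G g c0 \<noteq> 0"
  shows "hpoly_eval n d G (\<lambda>\<beta>. fps_const (g \<beta>)) (fam fps_const fps_X (\<lambda>_. 0)) \<noteq> 0"
proof -
  let ?p = "hpoly_eval n d G (\<lambda>\<beta>. [:g \<beta>:]) (fam (\<lambda>e. [:e:]) [:0, 1:] (\<lambda>_. 0))"
  have h1: "hom_on UNIV (\<lambda>p. poly p (1::'k))" and h2: "hom_on UNIV (fps_of_poly :: 'k poly \<Rightarrow> _)"
    by (auto simp: hom_on_def is_subring_def fps_of_poly_add fps_of_poly_mult)
  have "poly ?p 1 = hpoly_eval n d G g c0"
    unfolding hom_on_hpoly_eval(2)[OF h1, OF UNIV_I UNIV_I]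
    using c0 by (simp add: hpoly_eval_def fam_def seg_def)
  then have "?p \<noteq> 0" using G by auto
  moreover have "fps_of_poly ?p = hpoly_eval n d G (\<lambda>\<beta>. fps_const (g \<beta>)) (fam fps_const fps_X (\<lambda>_. 0))"
    unfolding hom_on_hpoly_eval(2)[OF h2, OF UNIV_I UNIV_I]
    by (intro arg_cong2[of _ _ _ _ "hpoly_eval n d G"] ext)
       (auto simp: fam_def seg_def fps_of_poly_add fps_of_poly_mult fps_of_poly_diff fps_of_poly_pCons one_pCons)
  ultimately show ?thesis by (metis fps_of_poly_0 fps_of_poly_eq_iff)
qed

lemma exists_nearby_periodic_critical:
  assumes c0: "\<And>v. v \<notin> coeff_idx n d \<Longrightarrow> c0 v = 0" and G: "hpoly_eval n d G g c0 \<noteq> 0"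
  shows "\<exists>c. End_rep n d c \<and> hpoly_eval n d G g c \<noteq> 0 \<and> has_periodic_crit_pt n d c"
proof -
  define F where "F T = hpoly_eval n d G (\<lambda>\<beta>. fps_const (g \<beta>)) (fam fps_const fps_X T)" for T
  have poly_fun_F: "poly_fun F"
    unfolding F_def
  proof (rule poly_fun_hpoly_eval)
    fix v
    show "poly_fun (\<lambda>T. fam fps_const fps_X T v)"
      unfolding fam_def by (cases "v \<in> coeff_idx n d") (auto intro!: poly_fun_add poly_fun_mult poly_fun_sum poly_fun_const poly_fun_var)
  qed
  have "F (\<lambda>_. 0) \<noteq> 0" unfolding F_def by (rule hpoly_eval_fam_nonzero[OF c0 G])
  then obtain m0 where "F (\<lambda>_. 0) $ m0 \<noteq> 0" by (auto simp: fps_eq_iff)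
  then have ex: "\<exists>t. F (\<lambda>j. fps_const (t j)) $ m0 \<noteq> 0" by (intro exI[of _ "\<lambda>_. 0"]) simp
  \<comment> \<open>Minimal over all constant t at once: this gives the vanishing below m for every
    t that \<open>poly_fun_leading_coeff\<close> requires.\<close>
  define m where "m = (LEAST m. \<exists>t. F (\<lambda>j. fps_const (t j)) $ m \<noteq> 0)"
  obtain t' where t': "F (\<lambda>j. fps_const (t' j)) $ m \<noteq> 0" using LeastI_ex[of "\<lambda>m. \<exists>t. F (\<lambda>j. fps_const (t j)) $ m \<noteq> 0"] ex unfolding m_def by blast
  have low: "F (\<lambda>j. fps_const (t j)) $ i = 0" if "i < m" for t i
    using not_less_Least[OF that[unfolded m_def]] by blast
  obtain t where t: "\<forall>j\<in>J. t j \<in> {t. \<exists>s. poly (center_poly d (Suc s)) t = 0}" "F (\<lambda>j. fps_const (t j)) $ m \<noteq> 0"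
    using poly_fun_nonzero_on_infinite[OF poly_fun_F J(1) infinite_centers[OF d] t'] by blast
  then have "\<forall>j\<in>J. \<exists>s. poly (center_poly d (Suc s)) (t j) = 0" by blast
  from bchoice[OF this] obtain p where p: "\<And>j. j \<in> J \<Longrightarrow> poly (center_poly d (Suc (p j))) (t j) = 0"
    by blast
  \<comment> \<open>The product of the individual periods is a common period for all
    coordinates.\<close>
  have "(\<Prod>j\<in>J. Suc (p j)) > 0" by (intro prod_pos) auto
  then obtain s where s: "Suc s = (\<Prod>j\<in>J. Suc (p j))" using gr0_implies_Suc by metis
  have roots: "poly (center_poly d (Suc s)) (t j) = 0" if "j \<in> J" for j
  proof -
    have "Suc (p j) dvd Suc s" unfolding s using J(1) that by (intro dvd_prodI) auto
    then obtain q where "Suc s = Suc (p j) * q" by (auto elim: dvdE)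
    then show ?thesis using center_poly_cycle[OF p[OF that], of q] by simp
  qed
  obtain T where T: "\<And>j. T j $ 0 = t j" "\<And>j. j \<in> J \<Longrightarrow> orb T (Suc s) j = 0"
    using exists_periodic_lift[of s t] roots by blast
  have "F T $ m = F (\<lambda>j. fps_const (t j)) $ m"
    using poly_fun_leading_coeff[OF poly_fun_F low, of m T] T(1) by simp
  then have "F T \<noteq> 0" using t(2) by auto
  then show ?thesis unfolding F_def by (intro periodic_critical_specialization[OF T(2)])
qed

end

theorem theorem3:
  fixes n d :: nat
  assumes "n \<ge> 1" and "d \<ge> 2"
  shows "zariski_dense_in_End n d
           (has_periodic_crit_pt n d :: (nat \<times> nat list \<Rightarrow> 'k::{alg_closed_field, field_char_0}) \<Rightarrow> bool)"
  unfolding zariski_dense_in_End_def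
proof (intro allI impI)
  fix e :: nat and G and g :: "(nat \<times> nat list \<Rightarrow> nat) \<Rightarrow> 'k"
  assume "\<exists>c. End_rep n d c \<and> hpoly_eval n d G g c \<noteq> 0"
  then obtain c0 where c0: "End_rep n d c0" "hpoly_eval n d G g c0 \<noteq> 0" by blast
  obtain P where P: "nontrivial n P" "jac_eval n d c0 P = 0"
    using exists_critical_point[OF assms] by blast
  then obtain w where w: "nontrivial n w"
    "\<And>i. i \<le> n \<Longrightarrow> (\<Sum>j\<le>n. form_deriv_eval n d c0 i j P * w j) = 0"
    unfolding jac_eval_eq_0_iff by blast
  obtain a b A B where AB: "a \<le> n" "b \<le> n" "a \<noteq> b" "inverse_on n A B" "inverse_on n B A"
    "\<And>i. A i a = P i" "\<And>i. A i b = w i"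
    using adapted_coordinates[OF c0(1) _ P(1) w] assms(2) by (metis le_trans one_le_numeral)
  \<comment> \<open>The power map of the coordinates y = B x, transported back to x, is again a
    tuple of forms of degree d, hence given by some \<open>b0\<close>.\<close>
  have "isform n (d * 1) (\<lambda>x. clin n A (\<lambda>l. clin n B x l ^ d) i)" for i
    unfolding lin_def[of n "\<lambda>i j. fps_const (A i j)"]
    by (intro isform_sum isform_cmult isform_power isform_lin)
  then have "isform n d (\<lambda>x. clin n A (\<lambda>l. clin n B x l ^ d) i)" for i by simp
  then obtain b0 where "\<And>i x. i \<le> n \<Longrightarrow>
      form_eval n d (\<lambda>v. fps_const (b0 v)) i x = clin n A (\<lambda>l. clin n B x l ^ d) i"
    using isform_eq_form_eval[of n d "\<lambda>i x. clin n A (\<lambda>l. clin n B x l ^ d) i"] by metis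
  then interpret marked_family n d a b A B P w c0 b0
    using assms AB P w by unfold_locales auto
  show "\<exists>c. End_rep n d c \<and> hpoly_eval n d G g c \<noteq> 0 \<and> has_periodic_crit_pt n d c"
    using c0 by (intro exists_nearby_periodic_critical) (auto simp: End_rep_def)
qed

end
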